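(* Let $F=\{v_1,\dots,v_k\}\subset S^{n-1}$ be a finite set and let $(u_m)_{m\ge1}$ be a sequence of vectors chosen from $F$. Then, for every compact set $K\subset\mathbb{R}^n$, the symmetrals $$K_m=\mathcal{S}_{u_m}\cdots\mathcal{S}_{u_1}K$$ converge, as $m\to\infty$, in Hausdorff distance and in symmetric difference to a compact set $L$. Furthermore, $L$ is symmetric under reflection at the hyperplane $v^\perp$ for each direction $v\in F$ that appears in the sequence $(u_m)$ infinitely often.
   Context: $S^{n-1}$ is the unit sphere of $\mathbb{R}^n$ and $\lambda_n$ is Lebesgue measure on $\mathbb{R}^n$; $u^\perp$ is the $(n-1)$-dimensional subspace orthogonal to $u$. For $\delta>0$, $K_{(\delta)}=K+B_\delta$ denotes the outer parallel set, where $B_\delta$ is the closed ball of radius $\delta$ centered at the origin; the Hausdorff distance of compact sets $K,L$ is $d_H(K,L)=\inf\{\delta>0: K\subset L_{(\delta)}\text{ and }L\subset K_{(\delta)}\}$. A sequence of compact sets $(K_m)$ converges in symmetric difference to a compact set $L$ if $\lim_{m\to\infty}\lambda_n(K_m\bigtriangleup L)=0$. Steiner symmetral: for $u\in S^{n-1}$ and $K\subset\mathbb{R}^n$ compact, $\mathcal{S}_uK$ is the compact set defined as follows. For $y\in u^\perp$, let $\ell_y=y+\mathbb{R}u$. If $\ell_y\cap K\ne\emptyset$, then $\ell_y\cap\mathcal{S}_uK$ is the closed line segment in $\ell_y$ centered at $y$ whose length is the one-dimensional Lebesgue measure of $\ell_y\cap K$ (the single point $\{y\}$ if this measure is zero);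 if $\ell_y\cap K=\emptyset$, then $\ell_y\cap\mathcal{S}_uK=\emptyset$. *)

theory Defs
  imports "HOL-Analysis.Analysis"
begin

definition outer_parallel :: "real \<Rightarrow> 'a::euclidean_space set \<Rightarrow> 'a set" where
  "outer_parallel \<delta> K = {x + b | x b. x \<in> K \<and> b \<in> cball 0 \<delta>}"

text \<open>The infimum is taken in the extended reals, where the infimum of the empty set is
  infinity: an empty and a nonempty set are at infinite distance.\<close>

definition hausdorff_distance :: "'a::euclidean_space set \<Rightarrow> 'a set \<Rightarrow> ereal" where
  "hausdorff_distance K L =
     Inf (ereal ` {\<delta>. 0 < \<delta> \<and> K \<subseteq> outer_parallel \<delta> L \<and> L \<subseteq> outer_parallel \<delta> K})"

text \<open>The intersection of \<open>K\<close> with the line through \<open>y\<close> in direction \<open>u\<close>, in the coordinate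
  \<open>t\<close> of the point \<open>y + t u\<close>. For a unit vector \<open>u\<close> this coordinate is an isometry.\<close>

definition line_section :: "'a::euclidean_space \<Rightarrow> 'a set \<Rightarrow> 'a \<Rightarrow> real set" where
  "line_section u K y = {t. y + t *\<^sub>R u \<in> K}"

definition steiner_symmetral :: "'a::euclidean_space \<Rightarrow> 'a set \<Rightarrow> 'a set" where
  "steiner_symmetral u K =
     {y + t *\<^sub>R u | y t. orthogonal u y \<and> line_section u K y \<noteq> {} \<and>
        \<bar>t\<bar> \<le> measure lebesgue (line_section u K y) / 2}"

text \<open>Indexed so that the directions used are \<open>u 1, u 2, \<dots>\<close>; the value \<open>u 0\<close> is irrelevant.\<close>

primrec iterated_symmetral ::
    "(nat \<Rightarrow> 'a::euclidean_space) \<Rightarrow> 'a set \<Rightarrow> nat \<Rightarrow> 'a set" where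
  "iterated_symmetral u K 0 = K"
| "iterated_symmetral u K (Suc m) = steiner_symmetral (u (Suc m)) (iterated_symmetral u K m)"

text \<open>Reflection at the hyperplane orthogonal to a unit vector \<open>v\<close>.\<close>

definition hyperplane_reflection :: "'a::euclidean_space \<Rightarrow> 'a \<Rightarrow> 'a" where
  "hyperplane_reflection v x = x - (2 * (x \<bullet> v)) *\<^sub>R v"

end

theory Submission
  imports Defs "HOL-Complex_Analysis.Great_Picard"
begin

text \<open>Write \<open>K\<^sub>\<delta>\<close> for the parallel set \<open>K + B\<^sub>\<delta>\<close>. Since \<open>(S\<^sub>u K)\<^sub>\<delta> \<subseteq> S\<^sub>u (K\<^sub>\<delta>)\<close>, both the volume
  and the moment \<open>\<mu>(K\<^sub>\<delta>)\<close>, where \<open>\<mu>\<close> has density \<open>1 + \<bar>x\<bar>\<^sup>2\<close>, decrease along the sequence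
  of symmetrals. Let \<open>L\<close> be a Hausdorff limit of a subsequence. If a direction \<open>w\<close> is applied to
  members of the sequence arbitrarily close to \<open>L\<close>, then \<open>\<mu>(S\<^sub>w (L\<^sub>\<delta>)) = \<mu>(L\<^sub>\<delta>)\<close> for all but
  countably many \<open>\<delta>\<close>, and strict monotonicity of \<open>\<mu>\<close> under symmetrization forces
  \<open>S\<^sub>w (L\<^sub>\<delta>) = L\<^sub>\<delta>\<close> up to null sets, hence the symmetry of \<open>L\<close>. Once \<open>L\<^sub>\<delta>\<close> is invariant, the inclusion
  \<open>K\<^sub>m \<subseteq> L\<^sub>\<delta>\<close> persists under further steps, while the lower bound on \<open>\<mu>((K\<^sub>m)\<^sub>\<delta>)\<close> gives the
  opposite inclusion. Volumes converge because \<open>\<lambda>(L) \<le> \<lambda>(K\<^sub>\<delta>)\<close> for all \<open>\<delta> > 0\<close> while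
  \<open>\<lambda>(K\<^sub>m) = \<lambda>(K)\<close>.\<close>

section \<open>Parallel sets\<close>

lemma outer_parallel_iff: "x \<in> outer_parallel \<delta> K \<longleftrightarrow> (\<exists>k\<in>K. dist k x \<le> \<delta>)"
proof
  assume "x \<in> outer_parallel \<delta> K"
  then obtain k b where "x = k + b" "k \<in> K" "norm b \<le> \<delta>"
    by (auto simp: outer_parallel_def)
  then show "\<exists>k\<in>K. dist k x \<le> \<delta>"
    by (intro bexI[of _ k]) (auto simp: dist_norm)
next
  assume "\<exists>k\<in>K. dist k x \<le> \<delta>"
  then obtain k where "k \<in> K" "dist k x \<le> \<delta>" by auto
  then show "x \<in> outer_parallel \<delta> K"
    unfolding outer_parallel_def
    by (intro CollectI exI[of _ k] exI[of _ "x - k"]) (auto simp: dist_norm norm_minus_commute)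
qed

lemma compact_outer_parallel: "compact K \<Longrightarrow> compact (outer_parallel \<delta> K)"
  unfolding outer_parallel_def by (intro compact_sums compact_cball)

lemma outer_parallel_mono: "K \<subseteq> L \<Longrightarrow> \<delta> \<le> \<epsilon> \<Longrightarrow> outer_parallel \<delta> K \<subseteq> outer_parallel \<epsilon> L"
  by (force simp: outer_parallel_iff)

lemma subset_outer_parallel: "0 \<le> \<delta> \<Longrightarrow> K \<subseteq> outer_parallel \<delta> K"
  by (force simp: outer_parallel_iff)

lemma outer_parallel_outer_parallel:
  "outer_parallel a (outer_parallel b K) \<subseteq> outer_parallel (a + b) K"
proof
  fix x assume "x \<in> outer_parallel a (outer_parallel b K)"
  then obtain y k where "dist y x \<le> a" "k \<in> K" "dist k y \<le> b"
    by (auto simp: outer_parallel_iff)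
  moreover have "dist k x \<le> dist k y + dist y x" by (rule dist_triangle)
  ultimately show "x \<in> outer_parallel (a + b) K"
    by (force simp: outer_parallel_iff)
qed

lemma outer_parallel_subset_add:
  assumes "K \<subseteq> outer_parallel b L"
  shows "outer_parallel a K \<subseteq> outer_parallel (a + b) L"
  using outer_parallel_mono[OF assms order_refl] outer_parallel_outer_parallel by blast

lemma INT_outer_parallel:
  assumes "closed L"
  shows "(\<Inter>n. outer_parallel (1 / real (Suc n)) L) = L"
proof
  show "L \<subseteq> (\<Inter>n. outer_parallel (1 / real (Suc n)) L)"
    by (intro INT_greatest subset_outer_parallel) simp
  show "(\<Inter>n. outer_parallel (1 / real (Suc n)) L) \<subseteq> L"
  proof
    fix x assume x: "x \<in> (\<Inter>n. outer_parallel (1 / real (Suc n)) L)"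
    have "\<exists>k\<in>L. dist k x < e" if e: "e > 0" for e
    proof -
      obtain n where "1 / real (Suc n) < e"
        using reals_Archimedean[OF e] by (auto simp: inverse_eq_divide)
      moreover obtain k where "k \<in> L" "dist k x \<le> 1 / real (Suc n)"
        using x by (auto simp: outer_parallel_iff)
      ultimately show ?thesis by force
    qed
    then show "x \<in> L"
      using assms by (metis closed_approachable)
  qed
qed

lemma mem_if_mem_outer_parallel:
  assumes "closed L" "\<And>\<delta>. 0 < \<delta> \<Longrightarrow> x \<in> outer_parallel \<delta> L"
  shows "x \<in> L"
  using INT_outer_parallel[OF assms(1)] assms(2) by (auto simp: set_eq_iff)

section \<open>Elementary properties of Steiner symmetrization\<close>

lemma line_section_shift:
  "line_section u K (y + s *\<^sub>R u) = (\<lambda>t. - s + t) ` line_section u K y"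
proof (intro set_eqI iffI)
  fix t assume "t \<in> line_section u K (y + s *\<^sub>R u)"
  then have "s + t \<in> line_section u K y" by (simp add: line_section_def scaleR_add_left add.assoc)
  then show "t \<in> (\<lambda>t. - s + t) ` line_section u K y" by (intro image_eqI[of _ _ "s + t"]) simp_all
qed (auto simp: line_section_def scaleR_add_left[symmetric] add.assoc)

lemma line_section_mono: "K \<subseteq> L \<Longrightarrow> line_section u K y \<subseteq> line_section u L y"
  by (auto simp: line_section_def)

lemma compact_line_section:
  assumes "norm u = 1" "compact K"
  shows "compact (line_section u K y)"
proof -
  have "closed (line_section u K y)"
    using continuous_closed_vimage[of K "\<lambda>t. y + t *\<^sub>R u"] compact_imp_closed[OF assms(2)]
    by (simp add: line_section_def vimage_def)
  moreover obtain B where B: "\<And>x. x \<in> K \<Longrightarrow> norm x \<le> B"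
    using compact_imp_bounded[OF assms(2)] by (auto simp: bounded_iff)
  have "norm t \<le> B + norm y" if "t \<in> line_section u K y" for t
  proof -
    have "norm (t *\<^sub>R u) \<le> norm (y + t *\<^sub>R u) + norm y"
      using norm_triangle_ineq4[of "y + t *\<^sub>R u" y] by simp
    then show ?thesis using B[of "y + t *\<^sub>R u"] that assms by (auto simp: line_section_def)
  qed
  then have "bounded (line_section u K y)" by (auto simp: bounded_iff)
  ultimately show ?thesis by (simp add: compact_eq_bounded_closed)
qed

text \<open>Moving the base point along the line only translates the section, so emptiness and
  length can be read at \<open>x\<close> itself and its foot in the orthogonal hyperplane never has
  to be named.\<close>

lemma steiner_symmetral_iff:
  assumes "norm u = 1"
  shows "x \<in> steiner_symmetral u K \<longleftrightarrow>
    line_section u K x \<noteq> {} \<and> \<bar>x \<bullet> u\<bar> \<le> measure lebesgue (line_section u K x) / 2"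
proof -
  have uu: "u \<bullet> u = 1" using assms by (simp add: dot_square_norm)
  have inv: "(line_section u K (y + s *\<^sub>R u) = {} \<longleftrightarrow> line_section u K y = {}) \<and>
      measure lebesgue (line_section u K (y + s *\<^sub>R u)) = measure lebesgue (line_section u K y)" for y s
    unfolding line_section_shift by (simp only: measure_translation image_is_empty)
  show ?thesis
  proof
    assume "x \<in> steiner_symmetral u K"
    then obtain y t where *: "x = y + t *\<^sub>R u" "orthogonal u y" "line_section u K y \<noteq> {}"
        "\<bar>t\<bar> \<le> measure lebesgue (line_section u K y) / 2"
      by (auto simp: steiner_symmetral_def)
    moreover have "x \<bullet> u = t"
      using * uu by (simp add: inner_simps orthogonal_def inner_commute)
    ultimately show "line_section u K x \<noteq> {} \<and> \<bar>x \<bullet> u\<bar> \<le> measure lebesgue (line_section u K x) / 2"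
      using inv[of y t] by simp
  next
    assume *: "line_section u K x \<noteq> {} \<and> \<bar>x \<bullet> u\<bar> \<le> measure lebesgue (line_section u K x) / 2"
    define y where "y = x + (- (x \<bullet> u)) *\<^sub>R u"
    have "x = y + (x \<bullet> u) *\<^sub>R u" by (simp add: y_def)
    moreover have "orthogonal u y"
      using uu by (simp add: y_def orthogonal_def inner_simps inner_commute)
    ultimately show "x \<in> steiner_symmetral u K"
      using * inv[of x "- (x \<bullet> u)", folded y_def] unfolding steiner_symmetral_def
      by (intro CollectI exI[of _ y] exI[of _ "x \<bullet> u"]) simp
  qed
qed

lemma steiner_symmetral_mono:
  assumes "norm u = 1" "compact K" "compact L" "K \<subseteq> L"
  shows "steiner_symmetral u K \<subseteq> steiner_symmetral u L"
proof
  fix x assume "x \<in> steiner_symmetral u K"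
  moreover have "measure lebesgue (line_section u K x) \<le> measure lebesgue (line_section u L x)"
    using compact_line_section[OF assms(1,2)] compact_line_section[OF assms(1,3)]
    by (intro measure_mono_fmeasurable line_section_mono assms fmeasurableD lmeasurable_compact)
  ultimately show "x \<in> steiner_symmetral u L"
    using line_section_mono[OF assms(4), of u x] by (auto simp: steiner_symmetral_iff[OF assms(1)])
qed

lemma norm_add_scaleR_sq:
  assumes "norm u = 1"
  shows "(norm (x + t *\<^sub>R u))\<^sup>2 = (norm x)\<^sup>2 - (x \<bullet> u)\<^sup>2 + (t + x \<bullet> u)\<^sup>2"
proof -
  have "u \<bullet> u = 1" using assms by (simp add: dot_square_norm)
  then show ?thesis
    unfolding power2_norm_eq_inner
    by (simp add: inner_simps inner_commute power2_eq_square algebra_simps)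
qed

text \<open>The line through \<open>x\<close> meets the ball in a segment of half-length
  \<open>\<rho>\<close> centred at the foot of \<open>x\<close>. A section inside it has length at
  most \<open>2 * \<rho>\<close>, and the symmetral recentres that length.\<close>

lemma steiner_symmetral_subset_cball:
  assumes "norm u = 1" "K \<subseteq> cball 0 R"
  shows "steiner_symmetral u K \<subseteq> cball 0 R"
proof
  fix x assume "x \<in> steiner_symmetral u K"
  then have ne: "line_section u K x \<noteq> {}" and le: "\<bar>x \<bullet> u\<bar> \<le> measure lebesgue (line_section u K x) / 2"
    by (auto simp: steiner_symmetral_iff[OF assms(1)])
  define q where "q = (norm x)\<^sup>2 - (x \<bullet> u)\<^sup>2"
  have sq: "q + (t + x \<bullet> u)\<^sup>2 \<le> R\<^sup>2" "R \<ge> 0" if "t \<in> line_section u K x" for t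
  proof -
    have n: "norm (x + t *\<^sub>R u) \<le> R" using that assms(2) by (auto simp: line_section_def)
    then show "R \<ge> 0" by (meson norm_ge_zero order_trans)
    show "q + (t + x \<bullet> u)\<^sup>2 \<le> R\<^sup>2"
      using power_mono[OF n, of 2] by (simp add: norm_add_scaleR_sq[OF assms(1)] q_def)
  qed
  obtain t0 where "t0 \<in> line_section u K x" using ne by blast
  from sq[OF this] have R: "R \<ge> 0" "q \<le> R\<^sup>2"
    using zero_le_power2[of "t0 + x \<bullet> u"] by linarith+
  define \<rho> where "\<rho> = sqrt (R\<^sup>2 - q)"
  have \<rho>: "\<rho> \<ge> 0" "\<rho>\<^sup>2 = R\<^sup>2 - q" using R by (auto simp: \<rho>_def)
  have "line_section u K x \<subseteq> {- (x \<bullet> u) - \<rho> .. - (x \<bullet> u) + \<rho>}"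
  proof
    fix t assume "t \<in> line_section u K x"
    then have "\<bar>t + x \<bullet> u\<bar> \<le> \<rho>" using sq(1)[of t] unfolding \<rho>_def by (intro real_le_rsqrt) auto
    then show "t \<in> {- (x \<bullet> u) - \<rho> .. - (x \<bullet> u) + \<rho>}" by auto
  qed
  \<comment> \<open>\<open>K\<close> is arbitrary here, so its section may fail to be measurable;
    \<open>measure\<close> is then 0.\<close>
  then have "measure lebesgue (line_section u K x) \<le> 2 * \<rho>"
    by (cases "line_section u K x \<in> sets lebesgue")
      (use measure_mono_fmeasurable[of "line_section u K x" "{- (x \<bullet> u) - \<rho> .. - (x \<bullet> u) + \<rho>}" lebesgue] \<rho>
        in \<open>auto simp: measure_notin_sets\<close>)
  then have "\<bar>x \<bullet> u\<bar> \<le> \<rho>" using le by simp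
  then have "(x \<bullet> u)\<^sup>2 \<le> \<rho>\<^sup>2" by (metis abs_le_square_iff abs_of_nonneg \<rho>(1))
  then have "(norm x)\<^sup>2 \<le> R\<^sup>2" using \<rho>(2) by (simp add: q_def)
  then show "x \<in> cball 0 R" using R by (auto dest: power2_le_imp_le)
qed

text \<open>One-dimensional Brunn-Minkowski for a set and a segment: besides a translate of
  \<open>A\<close>, the set \<open>B\<close> contains an interval of length \<open>r\<close> beyond
  the maximum of that translate and another below its minimum, and the three pieces are
  disjoint.\<close>

lemma measure_add_interval_le:
  fixes A B :: "real set"
  assumes "compact A" "A \<noteq> {}" "compact B" "0 \<le> r"
    and sub: "\<And>t w. t \<in> A \<Longrightarrow> \<bar>w\<bar> \<le> r \<Longrightarrow> p + t + w \<in> B"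
  shows "measure lebesgue A + 2 * r \<le> measure lebesgue B"
proof -
  obtain M where M: "M \<in> A" "\<And>t. t \<in> A \<Longrightarrow> t \<le> M" using compact_attains_sup[OF assms(1,2)] by blast
  obtain m where m: "m \<in> A" "\<And>t. t \<in> A \<Longrightarrow> m \<le> t" using compact_attains_inf[OF assms(1,2)] by blast
  define A' where "A' = (+) p ` A"
  define I where "I = {p + M <..< p + M + r}"
  define J where "J = {p + m - r <..< p + m}"
  have meas: "A' \<in> lmeasurable" "I \<in> lmeasurable" "J \<in> lmeasurable" "B \<in> lmeasurable"
    using assms unfolding A'_def I_def J_def
    by (auto intro!: lmeasurable_compact compact_translation)
  have "A' \<subseteq> {p + m .. p + M}" using M m by (auto simp: A'_def)
  moreover have "m \<le> M" using M m by blast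
  ultimately have d: "A' \<inter> I = {}" "(A' \<union> I) \<inter> J = {}" by (auto simp: I_def J_def)
  have "A' \<union> I \<union> J \<subseteq> B"
  proof -
    have "p + t \<in> B" if "t \<in> A" for t using sub[OF that, of 0] assms by simp
    moreover have "t \<in> B" if "t \<in> I" for t using sub[OF M(1), of "t - p - M"] that by (auto simp: I_def)
    moreover have "t \<in> B" if "t \<in> J" for t using sub[OF m(1), of "t - p - m"] that by (auto simp: J_def)
    ultimately show ?thesis by (auto simp: A'_def)
  qed
  then have "measure lebesgue (A' \<union> I \<union> J) \<le> measure lebesgue B"
    using meas by (intro measure_mono_fmeasurable) (auto intro: fmeasurableD)
  moreover have "measure lebesgue (A' \<union> I \<union> J) = measure lebesgue A' + measure lebesgue I + measure lebesgue J"
    using meas d measure_Un3[of "A' \<union> I" lebesgue J] measure_Un3[of A' lebesgue I]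
    by (simp add: fmeasurable.Un)
  moreover have "measure lebesgue A' = measure lebesgue A"
    unfolding A'_def by (rule measure_translation)
  moreover have "measure lebesgue I = r" "measure lebesgue J = r" using assms(4) by (auto simp: I_def J_def)
  ultimately show ?thesis by simp
qed

text \<open>A displacement with component \<open>s\<close> along \<open>u\<close> raises the
  distance to the hyperplane by at most \<open>\<bar>s\<bar>\<close>. In return, the section of the
  parallel set through \<open>z\<close> contains a translate of the section of \<open>K\<close>
  through \<open>x\<close>, widened by \<open>\<bar>s\<bar>\<close> on both sides.\<close>

lemma outer_parallel_steiner_symmetral:
  assumes "norm u = 1" "compact K"
  shows "outer_parallel \<delta> (steiner_symmetral u K) \<subseteq> steiner_symmetral u (outer_parallel \<delta> K)"
proof
  fix z assume "z \<in> outer_parallel \<delta> (steiner_symmetral u K)"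
  then obtain x where x: "x \<in> steiner_symmetral u K" "dist x z \<le> \<delta>" by (auto simp: outer_parallel_iff)
  define b where "b = z - x"
  define s where "s = b \<bullet> u"
  define A where "A = line_section u K x"
  define B where "B = line_section u (outer_parallel \<delta> K) z"
  have A: "A \<noteq> {}" "\<bar>x \<bullet> u\<bar> \<le> measure lebesgue A / 2"
    using x(1) by (auto simp: A_def steiner_symmetral_iff[OF assms(1)])
  have b: "norm b \<le> \<delta>" using x(2) by (simp add: b_def dist_norm norm_minus_commute)
  \<comment> \<open>The displacement \<open>b + (w - s) *\<^sub>R u\<close> agrees with
    \<open>b\<close> orthogonally to \<open>u\<close> and has component \<open>w\<close> along
    \<open>u\<close>, so it is no longer than \<open>b\<close>.\<close>
  have sub: "- s + t + w \<in> B" if "t \<in> A" "\<bar>w\<bar> \<le> \<bar>s\<bar>" for t w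
  proof -
    have "(norm (b + (w - s) *\<^sub>R u))\<^sup>2 = (norm b)\<^sup>2 - s\<^sup>2 + w\<^sup>2"
      by (simp add: norm_add_scaleR_sq[OF assms(1)] s_def)
    also have "\<dots> \<le> (norm b)\<^sup>2" using that(2) by (simp add: abs_le_square_iff)
    finally have "norm (b + (w - s) *\<^sub>R u) \<le> norm b" by (rule power2_le_imp_le) simp
    then have "dist (x + t *\<^sub>R u) (z + (- s + t + w) *\<^sub>R u) \<le> \<delta>"
      using b by (simp add: b_def dist_norm norm_minus_commute algebra_simps)
    then show ?thesis using that(1) by (auto simp: A_def B_def line_section_def outer_parallel_iff)
  qed
  have "measure lebesgue A + 2 * \<bar>s\<bar> \<le> measure lebesgue B"
    by (rule measure_add_interval_le[OF _ A(1) _ _ sub])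
      (auto simp: A_def B_def intro!: compact_line_section assms compact_outer_parallel)
  moreover have "z \<bullet> u = x \<bullet> u + s" by (simp add: s_def b_def inner_simps)
  ultimately have "\<bar>z \<bullet> u\<bar> \<le> measure lebesgue B / 2" using A(2) by linarith
  moreover have "B \<noteq> {}" using sub[of _ 0] A(1) by auto
  ultimately show "z \<in> steiner_symmetral u (outer_parallel \<delta> K)"
    by (simp add: B_def steiner_symmetral_iff[OF assms(1)])
qed

section \<open>Integration along lines and invariance of volume\<close>

text \<open>Fubini along the lines in direction \<open>u\<close> without choosing coordinates: every line meets the
  slab in a segment of length one, so integrating the line integrals over the slab
  gives the full integral, by translation invariance.\<close>

lemma nn_integral_lines:
  fixes u :: "'a::euclidean_space" and f :: "'a \<Rightarrow> ennreal"
  assumes u: "norm u = 1" and f [measurable]: "f \<in> borel_measurable borel"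
  shows "(\<integral>\<^sup>+x. f x \<partial>lborel) =
    (\<integral>\<^sup>+x. indicator {x. x \<bullet> u \<in> {0..1}} x * (\<integral>\<^sup>+t. f (x + t *\<^sub>R u) \<partial>lborel) \<partial>lborel)"
proof -
  define g :: "'a \<Rightarrow> ennreal" where "g = indicator {x. x \<bullet> u \<in> {0..1}}"
  have [measurable]: "{x. x \<bullet> u \<in> {0..1}} \<in> sets borel"
    by (rule borel_closed) (auto intro!: closed_Collect_conj closed_Collect_le continuous_intros)
  then have g [measurable]: "g \<in> borel_measurable borel" by (simp add: g_def)
  have uu: "u \<bullet> u = 1" using u by (simp add: dot_square_norm)
  have one: "(\<integral>\<^sup>+t. g (x - t *\<^sub>R u) \<partial>lborel) = 1" for x
  proof -
    have "g (x - t *\<^sub>R u) = indicator {x \<bullet> u - 1 .. x \<bullet> u} t" for t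
      using uu by (auto simp: g_def indicator_def inner_simps)
    then show ?thesis by simp
  qed
  have trans: "(\<integral>\<^sup>+x. g x * f (x + t *\<^sub>R u) \<partial>lborel) = (\<integral>\<^sup>+x. g (x - t *\<^sub>R u) * f x \<partial>lborel)" for t
  proof -
    have "(\<integral>\<^sup>+x. g (x - t *\<^sub>R u) * f x \<partial>lborel) =
        (\<integral>\<^sup>+x. g (x - t *\<^sub>R u) * f x \<partial>distr lborel borel ((+) (t *\<^sub>R u)))"
      by (simp add: lborel_distr_plus)
    also have "\<dots> = (\<integral>\<^sup>+x. g x * f (x + t *\<^sub>R u) \<partial>lborel)"
      by (subst nn_integral_distr) (auto simp: add.commute)
    finally show ?thesis ..
  qed
  have "(\<integral>\<^sup>+x. g x * (\<integral>\<^sup>+t. f (x + t *\<^sub>R u) \<partial>lborel) \<partial>lborel)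
      = (\<integral>\<^sup>+x. (\<integral>\<^sup>+t. g x * f (x + t *\<^sub>R u) \<partial>lborel) \<partial>lborel)"
    by (simp add: nn_integral_cmult)
  also have "\<dots> = (\<integral>\<^sup>+t. (\<integral>\<^sup>+x. g x * f (x + t *\<^sub>R u) \<partial>lborel) \<partial>lborel)"
    by (rule lborel_pair.Fubini'[symmetric]) measurable
  also have "\<dots> = (\<integral>\<^sup>+t. (\<integral>\<^sup>+x. g (x - t *\<^sub>R u) * f x \<partial>lborel) \<partial>lborel)"
    by (simp only: trans)
  also have "\<dots> = (\<integral>\<^sup>+x. (\<integral>\<^sup>+t. g (x - t *\<^sub>R u) * f x \<partial>lborel) \<partial>lborel)"
    by (rule lborel_pair.Fubini') measurable
  also have "\<dots> = (\<integral>\<^sup>+x. (\<integral>\<^sup>+t. g (x - t *\<^sub>R u) \<partial>lborel) * f x \<partial>lborel)"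
    by (simp add: nn_integral_multc)
  finally show ?thesis by (simp only: one mult_1_left g_def[symmetric])
qed

lemma emeasure_lines:
  fixes u :: "'a::euclidean_space"
  assumes "norm u = 1" "A \<in> sets borel"
  shows "emeasure lborel A = (\<integral>\<^sup>+x. indicator {x. x \<bullet> u \<in> {0..1}} x *
    emeasure lborel (line_section u A x) \<partial>lborel)"
proof -
  have "line_section u A x \<in> sets borel" for x
  proof -
    have "(\<lambda>t. x + t *\<^sub>R u) -` A \<inter> space borel \<in> sets borel"
      by (rule measurable_sets[OF _ assms(2)]) simp
    then show ?thesis by (simp add: line_section_def vimage_def)
  qed
  moreover have "indicator A (x + t *\<^sub>R u) = (indicator (line_section u A x) t :: ennreal)" for x t
    by (simp add: line_section_def indicator_def)
  ultimately show ?thesis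
    using nn_integral_lines[OF assms(1), of "indicator A"] assms(2) by simp
qed

text \<open>Upper semicontinuity of the section. The complement consists of the points
  \<open>k - t *\<^sub>R u\<close> with \<open>k\<close> in \<open>K\<close> and \<open>t\<close>
  outside \<open>U\<close>: a compact set plus a closed set, hence closed.\<close>

lemma open_line_section_subset:
  assumes "norm u = 1" "compact K" "open U"
  shows "open {x. line_section u K x \<subseteq> U}"
proof -
  have "closed ((\<lambda>t. (- t) *\<^sub>R u) ` (- U))"
    using assms
    by (intro closed_injective_linear_image)
      (auto simp: linear_iff algebra_simps inj_def closed_Compl)
  then have "closed (\<Union>k\<in>K. \<Union>v\<in>(\<lambda>t. (- t) *\<^sub>R u) ` (- U). {k + v})"
    by (rule compact_closed_sums[OF assms(2)])
  moreover have "(\<Union>k\<in>K. \<Union>v\<in>(\<lambda>t. (- t) *\<^sub>R u) ` (- U). {k + v}) = - {x. line_section u K x \<subseteq> U}"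
  proof (intro set_eqI iffI)
    fix x assume "x \<in> - {x. line_section u K x \<subseteq> U}"
    then obtain t where "x + t *\<^sub>R u \<in> K" "t \<notin> U" by (auto simp: line_section_def)
    then show "x \<in> (\<Union>k\<in>K. \<Union>v\<in>(\<lambda>t. (- t) *\<^sub>R u) ` (- U). {k + v})"
      by (intro UN_I[of "x + t *\<^sub>R u"] UN_I[of "(- t) *\<^sub>R u"]) auto
  qed (force simp: line_section_def)
  ultimately show ?thesis by (simp only: closed_def double_complement)
qed

text \<open>Section lengths are upper semicontinuous, so each way of lying outside the symmetral, an
  empty section or one shorter than \<open>2 * \<bar>x \<bullet> u\<bar>\<close>, persists near
  \<open>x\<close>.\<close>

lemma compact_steiner_symmetral:
  fixes u :: "'a::euclidean_space"
  assumes "norm u = 1" "compact K"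
  shows "compact (steiner_symmetral u K)"
proof -
  have "\<exists>T. open T \<and> x \<in> T \<and> T \<subseteq> - steiner_symmetral u K" if x: "x \<in> - steiner_symmetral u K" for x
  proof (cases "line_section u K x = {}")
    case True
    then show ?thesis
      using open_line_section_subset[OF assms, of "{}"]
      by (intro exI[of _ "{x. line_section u K x \<subseteq> {}}"]) (auto simp: steiner_symmetral_iff assms)
  next
    case False
    then have "\<bar>x \<bullet> u\<bar> > measure lebesgue (line_section u K x) / 2"
      using x by (simp add: steiner_symmetral_iff assms)
    then have "0 < (2 * \<bar>x \<bullet> u\<bar> - measure lebesgue (line_section u K x)) / 2" by simp
    define A where "A = line_section u K x"
    have A: "A \<in> lmeasurable" by (simp add: A_def lmeasurable_compact compact_line_section assms)
    obtain U where U: "open U" "A \<subseteq> U" "U - A \<in> lmeasurable"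
        "emeasure lebesgue (U - A) < ennreal ((2 * \<bar>x \<bullet> u\<bar> - measure lebesgue A) / 2)"
      using sets_lebesgue_outer_open[of A] A \<open>0 < _\<close> unfolding A_def by (metis fmeasurableD)
    have "measure lebesgue (U - A) < (2 * \<bar>x \<bullet> u\<bar> - measure lebesgue A) / 2"
      using U(3,4) by (simp add: emeasure_eq_measure2 ennreal_less_iff)
    moreover have "U = A \<union> (U - A)" using U by auto
    ultimately have Ul: "U \<in> lmeasurable" "measure lebesgue U < 2 * \<bar>x \<bullet> u\<bar>"
      using measure_Un2[OF A U(3)] fmeasurable.Un[OF A U(3)] \<open>0 < _\<close>
      by (simp_all add: A_def)
    define T where "T = {z. line_section u K z \<subseteq> U} \<inter> {z. measure lebesgue U < 2 * \<bar>z \<bullet> u\<bar>}"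
    have "open T"
      unfolding T_def
      by (intro open_Int open_line_section_subset assms U open_Collect_less continuous_intros)
    moreover have "x \<in> T" using U Ul by (auto simp: T_def A_def)
    moreover have "z \<notin> steiner_symmetral u K" if "z \<in> T" for z
    proof -
      have "measure lebesgue (line_section u K z) \<le> measure lebesgue U"
        using that Ul compact_line_section[OF assms, of z]
        by (intro measure_mono_fmeasurable) (auto simp: T_def fmeasurableD lmeasurable_compact)
      then show ?thesis using that by (auto simp: T_def steiner_symmetral_iff assms)
    qed
    ultimately show ?thesis by (intro exI[of _ T]) auto
  qed
  then have "closed (steiner_symmetral u K)"
    unfolding closed_def by (subst open_subopen) auto
  moreover obtain R where "K \<subseteq> cball 0 R"
    using compact_imp_bounded[OF assms(2)] by (auto simp: bounded_iff subset_iff)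
  then have "bounded (steiner_symmetral u K)"
    using steiner_symmetral_subset_cball[OF assms(1)] bounded_cball bounded_subset by metis
  ultimately show ?thesis by (simp add: compact_eq_bounded_closed)
qed

lemma line_section_steiner_symmetral:
  assumes "norm u = 1"
  shows "line_section u (steiner_symmetral u K) x =
    (let a = measure lebesgue (line_section u K x) / 2 in
     if line_section u K x = {} then {} else {- (x \<bullet> u) - a .. - (x \<bullet> u) + a})"
proof -
  have uu: "u \<bullet> u = 1" using assms by (simp add: dot_square_norm)
  have *: "t \<in> line_section u (steiner_symmetral u K) x \<longleftrightarrow>
      line_section u K x \<noteq> {} \<and> \<bar>x \<bullet> u + t\<bar> \<le> measure lebesgue (line_section u K x) / 2" for t
  proof -
    have "t \<in> line_section u (steiner_symmetral u K) x \<longleftrightarrow> x + t *\<^sub>R u \<in> steiner_symmetral u K"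
      by (simp add: line_section_def)
    also have "\<dots> \<longleftrightarrow>
      line_section u K x \<noteq> {} \<and> \<bar>x \<bullet> u + t\<bar> \<le> measure lebesgue (line_section u K x) / 2"
      unfolding steiner_symmetral_iff[OF assms] line_section_shift
      by (simp only: measure_translation image_is_empty) (simp add: inner_simps uu)
    finally show ?thesis .
  qed
  show ?thesis
  proof (intro set_eqI)
    fix t
    have **: "\<bar>x \<bullet> u + t\<bar> \<le> a \<longleftrightarrow> - (x \<bullet> u) - a \<le> t \<and> t \<le> - (x \<bullet> u) + a" for a
      by linarith
    show "t \<in> line_section u (steiner_symmetral u K) x \<longleftrightarrow>
      t \<in> (let a = measure lebesgue (line_section u K x) / 2 in
     if line_section u K x = {} then {} else {- (x \<bullet> u) - a .. - (x \<bullet> u) + a})"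
      unfolding * ** Let_def by auto
  qed
qed

section \<open>Cavalieri's principle and preservation of volume\<close>

lemma emeasure_line_section_steiner_symmetral:
  assumes "norm u = 1" "compact K"
  shows "emeasure lborel (line_section u (steiner_symmetral u K) x) = emeasure lborel (line_section u K x)"
proof -
  have "compact (line_section u K x)" by (rule compact_line_section[OF assms])
  then have "emeasure lborel (line_section u K x) = ennreal (measure lebesgue (line_section u K x))"
    using emeasure_compact_finite[of "line_section u K x"]
    by (simp add: emeasure_eq_ennreal_measure measure_completion borel_compact less_top)
  then show ?thesis
    by (auto simp: line_section_steiner_symmetral[OF assms(1)] Let_def)
qed

lemma emeasure_steiner_symmetral:
  fixes u :: "'a::euclidean_space"
  assumes "norm u = 1" "compact K"
  shows "emeasure lborel (steiner_symmetral u K) = emeasure lborel K"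
  using emeasure_lines[OF assms(1)] assms compact_steiner_symmetral[OF assms]
  by (simp add: emeasure_line_section_steiner_symmetral borel_compact)

section \<open>A strictly decreasing moment\<close>

text \<open>Exchange argument: \<open>I\<close> is the set where the weight is at most its value
  \<open>h\<close> at the endpoints, and it has the length of \<open>A\<close>. So
  \<open>I - A\<close> and \<open>A - I\<close> have equal measure, with weight at most
  \<open>h\<close> on the former and above \<open>h\<close> on the latter; equality leaves no room
  for \<open>A - I\<close>.\<close>

lemma
  fixes A :: "real set" and s c :: real
  assumes "compact A" "0 \<le> c"
  defines "a \<equiv> measure lebesgue A / 2"
  defines "I \<equiv> {- s - a .. - s + a}"
  defines "w \<equiv> \<lambda>t. ennreal (c + (t + s)\<^sup>2)"
  shows nn_integral_interval_le: "(\<integral>\<^sup>+t. w t * indicator I t \<partial>lborel) \<le> (\<integral>\<^sup>+t. w t * indicator A t \<partial>lborel)"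
    and nn_integral_interval_eq:
      "(\<integral>\<^sup>+t. w t * indicator I t \<partial>lborel) = (\<integral>\<^sup>+t. w t * indicator A t \<partial>lborel) \<Longrightarrow>
       emeasure lborel (sym_diff A I) = 0"
proof -
  define N where "N = (\<lambda>X. \<integral>\<^sup>+t. w t * indicator X t \<partial>lborel)"
  have w [measurable]: "w \<in> borel_measurable borel" by (simp add: w_def)
  have A [measurable]: "A \<in> sets borel" using assms by (simp add: borel_compact)
  have I [measurable]: "I \<in> sets borel" by (simp add: I_def)
  have a: "0 \<le> a" by (simp add: a_def)
  have finA: "emeasure lborel A < \<infinity>" using emeasure_compact_finite[OF assms(1)] by simp
  have mA: "emeasure lborel A = ennreal (2 * a)"
    using finA by (simp add: a_def measure_completion emeasure_eq_ennreal_measure)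
  have mI: "emeasure lborel I = ennreal (2 * a)" using a by (simp add: I_def)
  define h where "h = c + a\<^sup>2"
  have h: "0 \<le> h" using assms(2) by (simp add: h_def)
  have split: "N X = N (X \<inter> Y) + N (X - Y)" "emeasure lborel X = emeasure lborel (X \<inter> Y) + emeasure lborel (X - Y)"
    if [measurable]: "X \<in> sets borel" "Y \<in> sets borel" for X Y
  proof -
    have "N X = (\<integral>\<^sup>+t. w t * indicator (X \<inter> Y) t + w t * indicator (X - Y) t \<partial>lborel)"
      unfolding N_def by (intro nn_integral_cong) (auto simp: indicator_def)
    then show "N X = N (X \<inter> Y) + N (X - Y)" unfolding N_def by (subst (asm) nn_integral_add) auto
    show "emeasure lborel X = emeasure lborel (X \<inter> Y) + emeasure lborel (X - Y)"
      by (subst plus_emeasure) (auto intro!: arg_cong[where f="emeasure lborel"])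
  qed
  have fin: "emeasure lborel (A \<inter> I) \<noteq> \<infinity>" "emeasure lborel (A - I) \<noteq> \<infinity>"
    using finA emeasure_mono[of "A \<inter> I" A lborel] emeasure_mono[of "A - I" A lborel] by auto
  have eq: "emeasure lborel (I - A) = emeasure lborel (A - I)"
  proof -
    have "emeasure lborel (A \<inter> I) + emeasure lborel (I - A) =
        emeasure lborel (A \<inter> I) + emeasure lborel (A - I)"
      using split(2)[OF A I] split(2)[OF I A] mA mI by (auto simp: Int_commute)
    then show ?thesis using fin(1) by (simp add: ennreal_add_left_cancel)
  qed
  have NIA: "N (I - A) \<le> ennreal h * emeasure lborel (I - A)"
  proof -
    have "N (I - A) \<le> (\<integral>\<^sup>+t. ennreal h * indicator (I - A) t \<partial>lborel)"
      unfolding N_def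
    proof (intro nn_integral_mono)
      fix t
      have "(t + s)\<^sup>2 \<le> a\<^sup>2" if "t \<in> I"
        using that a by (auto simp: I_def abs_le_square_iff[symmetric])
      then show "w t * indicator (I - A) t \<le> ennreal h * indicator (I - A) t"
        by (auto simp: indicator_def w_def h_def intro!: ennreal_leI)
    qed
    then show ?thesis by (simp add: nn_integral_cmult_indicator)
  qed
  have gt: "h < c + (t + s)\<^sup>2" if "t \<in> A - I" for t
  proof -
    have "\<bar>a\<bar> < \<bar>t + s\<bar>" using that a by (auto simp: I_def)
    then show ?thesis by (simp add: h_def abs_le_square_iff flip: not_le)
  qed
  \<comment> \<open>Splitting off the constant \<open>h\<close> isolates the strictly positive
    excess on \<open>A - I\<close>, whose integral must vanish in the equality case.\<close>
  have NAI: "N (A - I) = (\<integral>\<^sup>+t. ennreal (c + (t + s)\<^sup>2 - h) * indicator (A - I) t \<partial>lborel)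
      + ennreal h * emeasure lborel (A - I)"
  proof -
    have "N (A - I) = (\<integral>\<^sup>+t. ennreal (c + (t + s)\<^sup>2 - h) * indicator (A - I) t
        + ennreal h * indicator (A - I) t \<partial>lborel)"
      unfolding N_def
    proof (intro nn_integral_cong)
      fix t
      show "w t * indicator (A - I) t = ennreal (c + (t + s)\<^sup>2 - h) * indicator (A - I) t
        + ennreal h * indicator (A - I) t"
        using gt[of t] h by (cases "t \<in> A - I") (auto simp: w_def simp flip: ennreal_plus)
    qed
    then show ?thesis by (subst (asm) nn_integral_add) (auto simp: nn_integral_cmult_indicator)
  qed
  have le: "N (I - A) \<le> N (A - I)"
    using NIA unfolding NAI eq by (rule order_trans) (simp add: add_increasing)
  then have "N I \<le> N A"
    using split(1)[OF A I] split(1)[OF I A] by (simp add: Int_commute add_left_mono)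
  then show "(\<integral>\<^sup>+t. w t * indicator I t \<partial>lborel) \<le> (\<integral>\<^sup>+t. w t * indicator A t \<partial>lborel)"
    by (simp add: N_def)
  assume "(\<integral>\<^sup>+t. w t * indicator I t \<partial>lborel) = (\<integral>\<^sup>+t. w t * indicator A t \<partial>lborel)"
  then have "N I = N A" by (simp add: N_def)
  have NI: "N I < \<infinity>"
  proof -
    have "N I \<le> (\<integral>\<^sup>+t. ennreal h * indicator I t \<partial>lborel)"
      unfolding N_def
    proof (intro nn_integral_mono)
      fix t
      have "(t + s)\<^sup>2 \<le> a\<^sup>2" if "t \<in> I"
        using that a by (auto simp: I_def abs_le_square_iff[symmetric])
      then show "w t * indicator I t \<le> ennreal h * indicator I t"
        by (auto simp: indicator_def w_def h_def intro!: ennreal_leI)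
    qed
    also have "\<dots> < \<infinity>" by (simp add: nn_integral_cmult_indicator mI ennreal_mult_less_top)
    finally show ?thesis .
  qed
  then have "N (A \<inter> I) \<noteq> \<infinity>" using split(1)[OF I A] by (auto simp: Int_commute)
  then have "N (I - A) = N (A - I)"
  proof -
    have "N (A \<inter> I) + N (I - A) = N (A \<inter> I) + N (A - I)"
      using \<open>N I = N A\<close> split(1)[OF A I] split(1)[OF I A] by (simp add: Int_commute)
    then show ?thesis using \<open>N (A \<inter> I) \<noteq> \<infinity>\<close> by (simp add: ennreal_add_left_cancel)
  qed
  then have "(\<integral>\<^sup>+t. ennreal (c + (t + s)\<^sup>2 - h) * indicator (A - I) t \<partial>lborel)
      + ennreal h * emeasure lborel (A - I) \<le> 0 + ennreal h * emeasure lborel (A - I)"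
    using NIA by (simp add: NAI eq)
  moreover have "ennreal h * emeasure lborel (A - I) \<noteq> \<infinity>"
    using fin by (simp add: ennreal_mult_eq_top_iff)
  ultimately have "(\<integral>\<^sup>+t. ennreal (c + (t + s)\<^sup>2 - h) * indicator (A - I) t \<partial>lborel) = 0"
    by (simp add: ennreal_add_left_cancel_le add.commute)
  then have "AE t in lborel. ennreal (c + (t + s)\<^sup>2 - h) * indicator (A - I) t = 0"
    by (subst (asm) nn_integral_0_iff_AE) auto
  then have "AE t in lborel. t \<notin> A - I"
    by eventually_elim (use gt in \<open>force simp: indicator_def\<close>)
  then have "emeasure lborel (A - I) = 0"
    by (subst (asm) AE_iff_measurable[of "A - I"]) auto
  then show "emeasure lborel (sym_diff A I) = 0"
    using eq emeasure_subadditive[of "A - I" lborel "I - A"] by simp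
qed

text \<open>The weight \<open>1 + \<bar>x\<bar>\<^sup>2\<close> increases strictly with the distance to the hyperplane of
  symmetrization, so symmetrization strictly decreases this measure unless it changes nothing;
  the summand \<open>1\<close> bounds the measure of balls from below.\<close>

definition moment_measure :: "'a::euclidean_space measure" where
  "moment_measure = density lborel (\<lambda>x. ennreal (1 + (norm x)\<^sup>2))"

lemma sets_moment_measure [simp, measurable_cong]: "sets moment_measure = sets borel"
  by (simp add: moment_measure_def)

lemma emeasure_moment_measure:
  "A \<in> sets borel \<Longrightarrow>
    emeasure moment_measure A = (\<integral>\<^sup>+x. ennreal (1 + (norm x)\<^sup>2) * indicator A x \<partial>lborel)"
  unfolding moment_measure_def by (rule emeasure_density) auto

lemma emeasure_lborel_le_moment_measure:
  assumes "A \<in> sets borel"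
  shows "emeasure lborel A \<le> emeasure moment_measure A"
proof -
  have "emeasure lborel A = (\<integral>\<^sup>+x. indicator A x \<partial>lborel)" using assms by simp
  also have "\<dots> \<le> emeasure moment_measure A"
    unfolding emeasure_moment_measure[OF assms]
    by (intro nn_integral_mono) (auto simp: indicator_def ennreal_ge_1)
  finally show ?thesis .
qed

lemma emeasure_moment_measure_compact:
  assumes "compact A"
  shows "emeasure moment_measure A < \<infinity>"
proof -
  obtain R where R: "\<And>x. x \<in> A \<Longrightarrow> norm x \<le> R"
    using compact_imp_bounded[OF assms] by (auto simp: bounded_iff)
  have "emeasure moment_measure A \<le> (\<integral>\<^sup>+x. ennreal (1 + R\<^sup>2) * indicator A x \<partial>lborel)"
    unfolding emeasure_moment_measure[OF borel_compact[OF assms]]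
    by (intro nn_integral_mono) (auto simp: indicator_def intro!: ennreal_leI power_mono R)
  also have "\<dots> < \<infinity>"
    using emeasure_compact_finite[OF assms] borel_compact[OF assms]
    by (simp add: nn_integral_cmult_indicator ennreal_mult_less_top)
  finally show ?thesis .
qed

text \<open>On each line the weight is \<open>c + (t + x \<bullet> u)\<^sup>2\<close>, so the
  one-dimensional exchange applies line by line. If the finite totals agree, the line integrals
  agree for almost every base point in the slab, and there the two sections differ by a null
  set.\<close>

lemma
  fixes u :: "'a::euclidean_space"
  assumes u: "norm u = 1" and K: "compact K"
  shows emeasure_moment_measure_steiner_symmetral_le:
      "emeasure moment_measure (steiner_symmetral u K) \<le> emeasure moment_measure K"
    and emeasure_moment_measure_steiner_symmetral_eq:
      "emeasure moment_measure (steiner_symmetral u K) = emeasure moment_measure K \<Longrightarrow>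
       emeasure lborel (sym_diff K (steiner_symmetral u K)) = 0"
proof -
  define S where "S = steiner_symmetral u K"
  have cS: "compact S" unfolding S_def by (rule compact_steiner_symmetral[OF u K])
  have [measurable]: "K \<in> sets borel" "S \<in> sets borel" using K cS by (auto intro: borel_compact)
  define g :: "'a \<Rightarrow> ennreal" where "g = indicator {x. x \<bullet> u \<in> {0..1}}"
  have [measurable]: "g \<in> borel_measurable borel"
    unfolding g_def
    by (intro borel_measurable_indicator borel_closed)
      (auto intro!: closed_Collect_conj closed_Collect_le continuous_intros)
  define W where "W = (\<lambda>X x. \<integral>\<^sup>+t. ennreal (1 + (norm (x + t *\<^sub>R u))\<^sup>2) * indicator X (x + t *\<^sub>R u) \<partial>lborel)"
  have W [measurable]: "W X \<in> borel_measurable borel" if [measurable]: "X \<in> sets borel" for X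
    unfolding W_def by measurable
  have mm: "emeasure moment_measure X = (\<integral>\<^sup>+x. g x * W X x \<partial>lborel)"
    if [measurable]: "X \<in> sets borel" for X
    unfolding emeasure_moment_measure[OF that] g_def W_def
    by (rule nn_integral_lines[OF u]) measurable
  have sec: "W S x \<le> W K x \<and>
      (W S x = W K x \<longrightarrow> emeasure lborel (line_section u (sym_diff K S) x) = 0)" for x
  proof -
    define c where "c = 1 + ((norm x)\<^sup>2 - (x \<bullet> u)\<^sup>2)"
    have "\<bar>x \<bullet> u\<bar> \<le> norm x" using Cauchy_Schwarz_ineq2[of x u] u by simp
    then have "0 \<le> c" using abs_le_square_iff[of "x \<bullet> u" "norm x"] by (simp add: c_def)
    have Weq: "W X x = (\<integral>\<^sup>+t. ennreal (c + (t + x \<bullet> u)\<^sup>2) * indicator (line_section u X x) t \<partial>lborel)" for X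
      unfolding W_def norm_add_scaleR_sq[OF u] c_def
      by (simp add: line_section_def indicator_def add.assoc)
    have cA: "compact (line_section u K x)" by (rule compact_line_section[OF u K])
    have diff: "line_section u (sym_diff K S) x =
        sym_diff (line_section u K x) (line_section u S x)"
      by (auto simp: line_section_def)
    show ?thesis
    \<comment> \<open>An empty section stays empty, whereas the interval of length zero would be a
      point.\<close>
    proof (cases "line_section u K x = {}")
      case True
      then show ?thesis unfolding Weq diff
        by (simp add: S_def line_section_steiner_symmetral[OF u] Let_def)
    next
      case False
      then show ?thesis
        using nn_integral_interval_le[OF cA \<open>0 \<le> c\<close>, of "x \<bullet> u"]
          nn_integral_interval_eq[OF cA \<open>0 \<le> c\<close>, of "x \<bullet> u"]
        unfolding Weq diff by (simp add: S_def line_section_steiner_symmetral[OF u] Let_def)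
    qed
  qed
  have le: "g x * W S x \<le> g x * W K x" for x using sec[of x] by (simp add: mult_left_mono)
  show "emeasure moment_measure (steiner_symmetral u K) \<le> emeasure moment_measure K"
    unfolding S_def[symmetric] by (simp add: mm nn_integral_mono le)
  assume "emeasure moment_measure (steiner_symmetral u K) = emeasure moment_measure K"
  then have eq: "(\<integral>\<^sup>+x. g x * W S x \<partial>lborel) = (\<integral>\<^sup>+x. g x * W K x \<partial>lborel)"
    by (simp add: mm S_def[symmetric])
  have fin: "(\<integral>\<^sup>+x. g x * W S x \<partial>lborel) \<noteq> \<infinity>"
    using emeasure_moment_measure_compact[OF cS] by (simp add: mm)
  have "(\<integral>\<^sup>+x. g x * W K x - g x * W S x \<partial>lborel) = 0"
    using eq fin le by (subst nn_integral_diff) auto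
  \<comment> \<open>Subtraction in \<open>ennreal\<close> is truncated: a vanishing difference only
    bounds the integral for \<open>K\<close> by that for \<open>S\<close>, and \<open>le\<close>
    supplies the other inequality.\<close>
  then have "AE x in lborel. g x * W K x - g x * W S x = 0"
    by (subst (asm) nn_integral_0_iff_AE) auto
  moreover have "AE x in lborel. g x * W S x \<noteq> \<infinity>"
    by (rule nn_integral_PInf_AE[OF _ fin]) measurable
  ultimately have "AE x in lborel. g x * emeasure lborel (line_section u (sym_diff K S) x) = 0"
  proof eventually_elim
    case (elim x)
    then have "g x * W S x = g x * W K x"
      using le[of x] by (metis antisym diff_eq_0_iff_ennreal infinity_ennreal_def ennreal_minus_eq_0)
    then show ?case using sec[of x] by (auto simp: g_def indicator_def)
  qed
  then have "(\<integral>\<^sup>+x. g x * emeasure lborel (line_section u (sym_diff K S) x) \<partial>lborel) = (\<integral>\<^sup>+x. 0 \<partial>(lborel :: 'a measure))"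
    by (rule nn_integral_cong_AE)
  then show "emeasure lborel (sym_diff K (steiner_symmetral u K)) = 0"
    unfolding S_def[symmetric] by (simp add: emeasure_lines[OF u] g_def)
qed

section \<open>Blaschke selection\<close>

text \<open>The functions \<open>infdist x (A n)\<close> are uniformly bounded on the ball and
  1-Lipschitz, so Arzela-Ascoli gives a uniformly convergent subsequence; \<open>L\<close> is the
  zero set of its limit \<open>g\<close>.\<close>

lemma Blaschke_selection:
  fixes A :: "nat \<Rightarrow> 'a::euclidean_space set"
  assumes A: "\<And>n. compact (A n)" "\<And>n. A n \<noteq> {}" "\<And>n. A n \<subseteq> cball 0 R"
  obtains L r where "compact L" "strict_mono (r :: nat \<Rightarrow> nat)"
    "\<And>\<epsilon>. 0 < \<epsilon> \<Longrightarrow> \<forall>\<^sub>F j in sequentially.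
       A (r j) \<subseteq> outer_parallel \<epsilon> L \<and> L \<subseteq> outer_parallel \<epsilon> (A (r j))"
proof -
  define S where "S = cball (0 :: 'a) R"
  have S: "compact S" by (simp add: S_def)
  obtain g r where g: "continuous_on S g" and r: "strict_mono (r :: nat \<Rightarrow> nat)"
    and conv: "\<And>e. 0 < e \<Longrightarrow> \<exists>N. \<forall>n x. n \<ge> N \<and> x \<in> S \<longrightarrow> norm (infdist x (A (r n)) - g x) < e"
  proof (rule Arzela_Ascoli[of S "\<lambda>n x. infdist x (A n)" "2 * R"])
    show "norm (infdist x (A n)) \<le> 2 * R" if "x \<in> S" for n x
    proof -
      obtain a where a: "a \<in> A n" using A(2) by blast
      have "infdist x (A n) \<le> dist x a" by (rule infdist_le[OF a])
      also have "\<dots> \<le> dist x 0 + dist a 0" by (rule dist_triangle2)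
      also have "\<dots> \<le> 2 * R" using that A(3)[of n] a by (auto simp: S_def)
      finally show ?thesis by (simp add: infdist_nonneg)
    qed
    show "\<exists>d>0. \<forall>n y. y \<in> S \<and> norm (x - y) < d \<longrightarrow> norm (infdist x (A n) - infdist y (A n)) < e"
      if "0 < e" for x e
    proof (intro exI[of _ e] conjI allI impI)
      fix n y assume "y \<in> S \<and> norm (x - y) < e"
      then show "norm (infdist x (A n) - infdist y (A n)) < e"
        using infdist_triangle_abs[of x "A n" y] by (simp add: dist_norm)
    qed (rule that)
  qed (use S in auto)
  define L where "L = {x \<in> S. g x = 0}"
  have L: "compact L"
    unfolding L_def compact_eq_bounded_closed
    using continuous_closed_preimage_constant[OF g compact_imp_closed[OF S], of 0]
      bounded_subset[OF compact_imp_bounded[OF S], of "{x \<in> S. g x = 0}"] by blast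
  have g0: "0 \<le> g x" if "x \<in> S" for x
  proof (rule ccontr)
    assume "\<not> 0 \<le> g x"
    then obtain N where "norm (infdist x (A (r N)) - g x) < - g x"
      using conv[of "- g x"] \<open>x \<in> S\<close> by (meson neg_0_less_iff_less not_le order_refl)
    then show False using infdist_nonneg[of x "A (r N)"] by (simp add: abs_less_iff)
  qed
  have "\<forall>\<^sub>F j in sequentially. A (r j) \<subseteq> outer_parallel \<epsilon> L \<and> L \<subseteq> outer_parallel \<epsilon> (A (r j))"
    if \<epsilon>: "0 < \<epsilon>" for \<epsilon>
  proof (rule eventually_conj)
    obtain N where N: "\<And>n x. n \<ge> N \<Longrightarrow> x \<in> S \<Longrightarrow> norm (infdist x (A (r n)) - g x) < \<epsilon>"
      using conv[OF \<epsilon>] by blast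
    have "L \<subseteq> outer_parallel \<epsilon> (A (r n))" if "n \<ge> N" for n
    proof
      fix x assume x: "x \<in> L"
      then have "infdist x (A (r n)) < \<epsilon>" using N[OF that, of x] by (simp add: L_def)
      moreover obtain a where "a \<in> A (r n)" "infdist x (A (r n)) = dist x a"
        using infdist_attains_inf[OF compact_imp_closed[OF A(1)] A(2)] by metis
      ultimately show "x \<in> outer_parallel \<epsilon> (A (r n))"
        by (auto simp: outer_parallel_iff dist_commute intro!: bexI[of _ a])
    qed
    then show "\<forall>\<^sub>F j in sequentially. L \<subseteq> outer_parallel \<epsilon> (A (r j))"
      unfolding eventually_sequentially by blast
    \<comment> \<open>The points of the ball at distance at least \<open>\<epsilon>\<close> from
      \<open>L\<close>. If \<open>C\<close> is nonempty, \<open>g\<close> has a positive minimum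
      there, and a set whose distance function is uniformly within that minimum of \<open>g\<close>
      cannot meet \<open>C\<close>.\<close>
    define C where "C = S \<inter> (\<Inter>k\<in>L. {x. \<epsilon> \<le> dist k x})"
    have C: "compact C"
      unfolding C_def
      by (intro compact_Int_closed[OF S] closed_INT ballI closed_Collect_le continuous_intros)
    have sub: "A (r j) \<subseteq> outer_parallel \<epsilon> L" if "A (r j) \<inter> C = {}" for j
      using that A(3)[of "r j"] by (force simp: C_def S_def outer_parallel_iff)
    show "\<forall>\<^sub>F j in sequentially. A (r j) \<subseteq> outer_parallel \<epsilon> L"
    proof (cases "C = {}")
      case True
      then show ?thesis using sub by simp
    next
      case False
      have "continuous_on C g" by (rule continuous_on_subset[OF g]) (simp add: C_def)
      then obtain c where c: "c \<in> C" "\<And>x. x \<in> C \<Longrightarrow> g c \<le> g x"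
        using continuous_attains_inf[OF C False] by blast
      have "c \<notin> L" using c(1) \<epsilon> by (auto simp: C_def)
      then have "0 < g c" using g0[of c] c(1) by (force simp: L_def C_def)
      then obtain M where M: "\<And>n x. n \<ge> M \<Longrightarrow> x \<in> S \<Longrightarrow> norm (infdist x (A (r n)) - g x) < g c"
        using conv by blast
      have "A (r n) \<inter> C = {}" if "n \<ge> M" for n
      proof (rule ccontr)
        assume "A (r n) \<inter> C \<noteq> {}"
        then obtain x where x: "x \<in> A (r n)" "x \<in> C" by blast
        then have "g x < g c" using M[OF that, of x] g0[of x] by (simp add: C_def infdist_zero)
        then show False using c(2)[OF x(2)] by simp
      qed
      then show ?thesis using sub unfolding eventually_sequentially by blast
    qed
  qed
  then show ?thesis using L r by (intro that) auto
qed

section \<open>Limits of parallel sets\<close>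

lemma fmeasurable_moment_measure_compact: "compact A \<Longrightarrow> A \<in> fmeasurable moment_measure"
  using emeasure_moment_measure_compact[of A] by (auto simp: fmeasurable_def borel_compact)

lemma measure_moment_measure_mono:
  "compact A \<Longrightarrow> compact B \<Longrightarrow> A \<subseteq> B \<Longrightarrow> measure moment_measure A \<le> measure moment_measure B"
  by (intro measure_mono_fmeasurable fmeasurable_moment_measure_compact) (auto intro: borel_compact)

lemma mono_measure_outer_parallel:
  "compact L \<Longrightarrow> mono (\<lambda>\<delta>. measure moment_measure (outer_parallel \<delta> L))"
  by (intro monoI measure_moment_measure_mono compact_outer_parallel outer_parallel_mono) auto

text \<open>Monotone functions have only countably many discontinuities. This provides radii at
  which the moment of a parallel set is continuous in the radius.\<close>

lemma mono_isCont_between: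
  fixes f :: "real \<Rightarrow> real"
  assumes "mono f" "a < b"
  obtains x where "a < x" "x < b" "isCont f x"
proof -
  have "uncountable ({a<..<b} - {x. \<not> isCont f x})"
    using mono_ctble_discont[OF assms(1)] assms(2)
    by (intro uncountable_minus_countable) (auto simp: uncountable_open_interval)
  then obtain x where "x \<in> {a<..<b} - {x. \<not> isCont f x}"
    by (metis countable_empty ex_in_conv)
  then show ?thesis using that by auto
qed

text \<open>A nearest point of \<open>L\<close> realizes the distance, so parallel sets are
  continuous from the right in the radius.\<close>

lemma mem_outer_parallel_rightI:
  assumes "compact L" "\<And>\<eta>. 0 < \<eta> \<Longrightarrow> x \<in> outer_parallel (\<delta> + \<eta>) L"
  shows "x \<in> outer_parallel \<delta> L"
proof -
  have "L \<noteq> {}" using assms(2)[of 1] by (auto simp: outer_parallel_iff)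
  then obtain k where k: "k \<in> L" "\<And>y. y \<in> L \<Longrightarrow> dist x k \<le> dist x y"
    using distance_attains_inf[OF compact_imp_closed[OF assms(1)], of x] by blast
  have "dist x k \<le> \<delta> + \<eta>" if "0 < \<eta>" for \<eta>
    using assms(2)[OF that] k(2) by (force simp: outer_parallel_iff dist_commute)
  then have "dist x k \<le> \<delta>" by (rule field_le_epsilon)
  then show ?thesis using k(1) by (auto simp: outer_parallel_iff dist_commute)
qed

text \<open>Turns inclusion up to null sets into membership: were \<open>x\<close> outside the
  closed set \<open>C\<close>, a small ball around \<open>x\<close> would have positive volume
  inside \<open>B - C\<close>.\<close>

lemma mem_closed_if_ball_null:
  fixes x :: "'a::euclidean_space"
  assumes "closed C" "B \<in> sets borel" "emeasure lborel (B - C) = 0" "0 < r" "ball x r \<subseteq> B"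
  shows "x \<in> C"
proof (rule ccontr)
  assume "x \<notin> C"
  then obtain e where e: "e > 0" "ball x e \<subseteq> - C"
    using assms(1) by (metis ComplI open_Compl openE)
  have [measurable]: "C \<in> sets borel" using assms(1) by simp
  have "emeasure lborel (ball x (min r e)) \<le> emeasure lborel (B - C)"
    using e assms by (intro emeasure_mono) (auto simp: subset_iff)
  then have "negligible (ball x (min r e))"
    using assms(3) by (auto simp: negligible_iff_null_sets null_sets_def)
  moreover have "ball x (min r e) \<noteq> {}" using assms(4) e(1) by simp
  ultimately show False using open_not_negligible[OF open_ball] by blast
qed

section \<open>Symmetry of a limit set from comparison of moments\<close>

lemma hyperplane_reflection_mem_steiner_symmetral:
  assumes "norm u = 1" "x \<in> steiner_symmetral u K"
  shows "hyperplane_reflection u x \<in> steiner_symmetral u K"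
proof -
  have uu: "u \<bullet> u = 1" using assms by (simp add: dot_square_norm)
  have eq: "hyperplane_reflection u x = x + (- (2 * (x \<bullet> u))) *\<^sub>R u"
    by (simp add: hyperplane_reflection_def)
  show ?thesis
    using assms(2)
    unfolding steiner_symmetral_iff[OF assms(1)] eq line_section_shift
    by (simp only: measure_translation image_is_empty) (simp add: inner_simps uu)
qed

lemma hyperplane_reflection_involution:
  "norm u = 1 \<Longrightarrow> hyperplane_reflection u (hyperplane_reflection u x) = x"
  by (simp add: hyperplane_reflection_def inner_simps dot_square_norm algebra_simps)

text \<open>The inclusion of symmetrized parallel sets lets a bound
  \<open>A \<subseteq> outer_parallel \<delta> L\<close> survive a step in direction
  \<open>v\<close>; the reflection is the symmetry finally claimed for the limit.\<close>

definition parallel_invariant :: "'a::euclidean_space \<Rightarrow> 'a set \<Rightarrow> bool" where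
  "parallel_invariant v L \<longleftrightarrow>
     (\<forall>\<delta>>0. steiner_symmetral v (outer_parallel \<delta> L) \<subseteq> outer_parallel \<delta> L) \<and>
     hyperplane_reflection v ` L = L"

text \<open>The gap between \<open>\<delta>'\<close> and \<open>\<delta>\<close> absorbs Hausdorff
  errors; at radii where the moment of the parallel sets of \<open>L\<close> is continuous, nothing
  is lost by it.\<close>

definition moment_dominates :: "'a::euclidean_space set \<Rightarrow> 'a set \<Rightarrow> bool" where
  "moment_dominates A L \<longleftrightarrow> (\<forall>\<delta>' \<delta>. \<delta>' < \<delta> \<longrightarrow>
     measure moment_measure (outer_parallel \<delta>' L) \<le> measure moment_measure (outer_parallel \<delta> A))"

text \<open>Through an approximating \<open>A\<close>, domination bounds the moment of
  \<open>outer_parallel \<delta>' L\<close> by that of the symmetral of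
  \<open>outer_parallel \<delta> L\<close>. Letting \<open>\<delta>'\<close> increase to a
  continuity radius \<open>\<delta>\<close> gives equal moments, hence equality up to a null set; a
  slight change of radius removes the null set.\<close>

lemma parallel_invariantI:
  fixes w :: "'a::euclidean_space"
  assumes w: "norm w = 1" and L: "compact L"
    and approx: "\<And>\<epsilon>. 0 < \<epsilon> \<Longrightarrow> \<exists>A. compact A \<and> A \<subseteq> outer_parallel \<epsilon> L \<and>
      moment_dominates (steiner_symmetral w A) L"
  shows "parallel_invariant w L"
proof -
  define f where "f = (\<lambda>\<delta>. measure moment_measure (outer_parallel \<delta> L))"
  have mono: "mono f" unfolding f_def by (rule mono_measure_outer_parallel[OF L])
  have cP: "compact (outer_parallel \<delta> L)" for \<delta> by (rule compact_outer_parallel[OF L])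
  have cS: "compact (steiner_symmetral w (outer_parallel \<delta> L))" for \<delta>
    by (rule compact_steiner_symmetral[OF w cP])
  have le: "f \<delta>' \<le> measure moment_measure (steiner_symmetral w (outer_parallel \<delta> L))"
    if less: "\<delta>' < \<delta>" for \<delta>' \<delta>
  proof -
    \<comment> \<open>One half of the gap pays for the distance from \<open>A\<close> to
      \<open>L\<close>, the other keeps \<open>\<delta>' < \<delta> - \<epsilon>\<close> as
      domination requires.\<close>
    define \<epsilon> where "\<epsilon> = (\<delta> - \<delta>') / 2"
    obtain A where A: "compact A" "A \<subseteq> outer_parallel \<epsilon> L" "moment_dominates (steiner_symmetral w A) L"
      using approx[of \<epsilon>] less by (auto simp: \<epsilon>_def)
    have "f \<delta>' \<le> measure moment_measure (outer_parallel (\<delta> - \<epsilon>) (steiner_symmetral w A))"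
      using A(3) less unfolding f_def moment_dominates_def \<epsilon>_def by (simp add: field_simps)
    also have "\<dots> \<le> measure moment_measure (steiner_symmetral w (outer_parallel \<delta> L))"
    proof (intro measure_moment_measure_mono compact_outer_parallel compact_steiner_symmetral w A L)
      have "outer_parallel (\<delta> - \<epsilon>) (steiner_symmetral w A) \<subseteq> steiner_symmetral w (outer_parallel (\<delta> - \<epsilon>) A)"
        by (rule outer_parallel_steiner_symmetral[OF w A(1)])
      also have "\<dots> \<subseteq> steiner_symmetral w (outer_parallel \<delta> L)"
        using outer_parallel_subset_add[OF A(2), of "\<delta> - \<epsilon>"]
        by (intro steiner_symmetral_mono w cP compact_outer_parallel A) simp
      finally show "outer_parallel (\<delta> - \<epsilon>) (steiner_symmetral w A) \<subseteq> steiner_symmetral w (outer_parallel \<delta> L)" .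
    qed
    finally show ?thesis .
  qed
  have null: "emeasure lborel (sym_diff (outer_parallel \<delta> L) (steiner_symmetral w (outer_parallel \<delta> L))) = 0"
    if "isCont f \<delta>" for \<delta>
  proof (rule emeasure_moment_measure_steiner_symmetral_eq[OF w cP], rule antisym)
    show "emeasure moment_measure (steiner_symmetral w (outer_parallel \<delta> L)) \<le> emeasure moment_measure (outer_parallel \<delta> L)"
      by (rule emeasure_moment_measure_steiner_symmetral_le[OF w cP])
    have "(f \<longlongrightarrow> f \<delta>) (at_left \<delta>)"
      using that by (simp add: isCont_def filterlim_at_split)
    then have "f \<delta> \<le> measure moment_measure (steiner_symmetral w (outer_parallel \<delta> L))"
      by (rule tendsto_upperbound) (auto simp: eventually_at_filter le)
    then show "emeasure moment_measure (outer_parallel \<delta> L) \<le> emeasure moment_measure (steiner_symmetral w (outer_parallel \<delta> L))"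
      using fmeasurable_moment_measure_compact[OF cP] fmeasurable_moment_measure_compact[OF cS]
      by (simp add: f_def emeasure_eq_measure2 ennreal_leI)
  qed
  have null1: "emeasure lborel (steiner_symmetral w (outer_parallel \<delta> L) - outer_parallel \<delta> L) = 0"
    and null2: "emeasure lborel (outer_parallel \<delta> L - steiner_symmetral w (outer_parallel \<delta> L)) = 0"
    if "isCont f \<delta>" for \<delta>
  proof -
    have "sym_diff (outer_parallel \<delta> L) (steiner_symmetral w (outer_parallel \<delta> L)) \<in> sets borel"
      using borel_compact[OF cP] borel_compact[OF cS] by auto
    then show "emeasure lborel (steiner_symmetral w (outer_parallel \<delta> L) - outer_parallel \<delta> L) = 0"
      "emeasure lborel (outer_parallel \<delta> L - steiner_symmetral w (outer_parallel \<delta> L)) = 0"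
      using null[OF that] by (auto intro: emeasure_eq_0)
  qed
  have inv: "steiner_symmetral w (outer_parallel \<delta> L) \<subseteq> outer_parallel \<delta> L" if "0 < \<delta>" for \<delta>
  proof
    fix x assume x: "x \<in> steiner_symmetral w (outer_parallel \<delta> L)"
    show "x \<in> outer_parallel \<delta> L"
    proof (rule mem_outer_parallel_rightI[OF L])
      fix \<eta> :: real assume "0 < \<eta>"
      \<comment> \<open>Enlarging the radius from \<open>\<delta>\<close> to \<open>d\<close> puts a
        whole ball around \<open>x\<close> into the symmetral of \<open>outer_parallel d L\<close>,
        so the null difference at \<open>d\<close> forces \<open>x\<close> into
        \<open>outer_parallel d L\<close>.\<close>
      then obtain d where d: "\<delta> < d" "d < \<delta> + \<eta>" "isCont f d"
        using mono_isCont_between[OF mono, of \<delta> "\<delta> + \<eta>"] by auto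
      have "ball x (d - \<delta>) \<subseteq> outer_parallel (d - \<delta>) (steiner_symmetral w (outer_parallel \<delta> L))"
        using x by (force simp: outer_parallel_iff)
      also have "\<dots> \<subseteq> steiner_symmetral w (outer_parallel (d - \<delta>) (outer_parallel \<delta> L))"
        by (rule outer_parallel_steiner_symmetral[OF w cP])
      also have "\<dots> \<subseteq> steiner_symmetral w (outer_parallel d L)"
        using outer_parallel_outer_parallel[of "d - \<delta>" \<delta> L]
        by (intro steiner_symmetral_mono w cP compact_outer_parallel) simp
      finally have "x \<in> outer_parallel d L"
        using d by (intro mem_closed_if_ball_null[OF compact_imp_closed[OF cP] borel_compact[OF cS] null1[OF d(3)], of "d - \<delta>"]) auto
      then show "x \<in> outer_parallel (\<delta> + \<eta>) L"
        using outer_parallel_mono[OF order_refl, of d "\<delta> + \<eta>" L] d by auto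
    qed
  qed
  \<comment> \<open>For small continuity radii \<open>d\<close>, the ball around \<open>x\<close>
    puts \<open>x\<close> into the symmetral of \<open>outer_parallel d L\<close>, which is
    symmetric by construction and lies in \<open>outer_parallel d L\<close> by
    \<open>inv\<close>.\<close>
  have refl: "hyperplane_reflection w x \<in> L" if x: "x \<in> L" for x
  proof (rule mem_if_mem_outer_parallel[OF compact_imp_closed[OF L]])
    fix \<delta> :: real assume "0 < \<delta>"
    then obtain d where d: "0 < d" "d < \<delta>" "isCont f d"
      using mono_isCont_between[OF mono, of 0 \<delta>] by auto
    have "ball x d \<subseteq> outer_parallel d L" using x by (force simp: outer_parallel_iff)
    then have "x \<in> steiner_symmetral w (outer_parallel d L)"
      by (rule mem_closed_if_ball_null[OF compact_imp_closed[OF cS] borel_compact[OF cP] null2[OF d(3)] d(1)])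
    then have "hyperplane_reflection w x \<in> outer_parallel d L"
      using hyperplane_reflection_mem_steiner_symmetral[OF w] inv[OF d(1)] by blast
    then show "hyperplane_reflection w x \<in> outer_parallel \<delta> L"
      using outer_parallel_mono[OF order_refl, of d \<delta> L] d by auto
  qed
  then have "hyperplane_reflection w ` L = L"
    using hyperplane_reflection_involution[OF w] by (auto simp: image_iff intro!: bexI[of _ "hyperplane_reflection w _"])
  then show ?thesis using inv by (simp add: parallel_invariant_def)
qed

text \<open>A point of \<open>L\<close> farther than \<open>\<eta>\<close> from \<open>A\<close>
  would carry a ball disjoint from \<open>outer_parallel \<delta> A\<close>, both inside a slightly
  larger parallel set of \<open>L\<close>. With domination, the moment of the parallel sets of
  \<open>L\<close> would then jump by a fixed amount at a continuity radius.\<close>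

lemma subset_outer_parallel_if_moment_dominates:
  fixes L :: "'a::euclidean_space set"
  assumes L: "compact L" and "0 < \<eta>"
  obtains \<epsilon> where "0 < \<epsilon>"
    "\<And>A. compact A \<Longrightarrow> A \<subseteq> outer_parallel \<epsilon> L \<Longrightarrow> moment_dominates A L \<Longrightarrow> L \<subseteq> outer_parallel \<eta> A"
proof -
  define f where "f = (\<lambda>\<delta>. measure moment_measure (outer_parallel \<delta> L))"
  \<comment> \<open>The bound \<open>\<eta> / 2\<close> makes the \<open>\<delta>\<close>-ball
    around a point \<open>\<eta>\<close>-far from \<open>A\<close> miss
    \<open>outer_parallel \<delta> A\<close>.\<close>
  obtain \<delta> where \<delta>: "0 < \<delta>" "\<delta> < \<eta> / 2" "isCont f \<delta>"
    using mono_isCont_between[OF mono_measure_outer_parallel[OF L], of 0 "\<eta> / 2"] assms(2)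
    unfolding f_def by auto
  \<comment> \<open>The moment density is at least 1, so \<open>\<kappa>\<close> bounds the moment
    of every ball of radius \<open>\<delta>\<close> from below, wherever its centre.\<close>
  define \<kappa> where "\<kappa> = measure lborel (ball (0::'a) \<delta>)"
  have \<kappa>: "0 < \<kappa>" using \<delta>(1) by (simp add: \<kappa>_def content_ball_pos)
  then obtain d where d: "0 < d" "\<And>y. \<bar>y - \<delta>\<bar> < d \<Longrightarrow> \<bar>f y - f \<delta>\<bar> < \<kappa> / 2"
    using \<delta>(3) unfolding continuous_at_eps_delta dist_real_def by (metis half_gt_zero)
  show ?thesis
  proof
    show "0 < d / 2" using d by simp
    fix A :: "'a set"
    assume A: "compact A" "A \<subseteq> outer_parallel (d / 2) L" "moment_dominates A L"
    show "L \<subseteq> outer_parallel \<eta> A"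
    proof
      fix x assume x: "x \<in> L"
      show "x \<in> outer_parallel \<eta> A"
      proof (rule ccontr)
        assume "x \<notin> outer_parallel \<eta> A"
        then have far: "\<eta> < dist k x" if "k \<in> A" for k using that by (force simp: outer_parallel_iff)
        have "y \<notin> outer_parallel \<delta> A" if "y \<in> ball x \<delta>" for y
        proof
          assume "y \<in> outer_parallel \<delta> A"
          then obtain k where "k \<in> A" "dist k y \<le> \<delta>" by (auto simp: outer_parallel_iff)
          then show False using far[of k] that \<delta>(2) dist_triangle[of k x y] by (auto simp: dist_commute)
        qed
        then have disj: "ball x \<delta> \<inter> outer_parallel \<delta> A = {}" by auto
        have cA: "compact (outer_parallel \<delta> A)" by (rule compact_outer_parallel[OF A(1)])
        have sub: "ball x \<delta> \<union> outer_parallel \<delta> A \<subseteq> outer_parallel (\<delta> + d / 2) L"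
          using outer_parallel_subset_add[OF A(2), of \<delta>] x d(1) by (force simp: outer_parallel_iff)
        have fm: "ball x \<delta> \<in> fmeasurable moment_measure"
          using fmeasurable_moment_measure_compact[OF compact_cball]
          by (rule fmeasurableI2[OF _ ball_subset_cball]) simp
        have "ennreal \<kappa> \<le> emeasure moment_measure (ball x \<delta>)"
          using emeasure_lborel_le_moment_measure[of "ball x \<delta>"] \<delta>(1)
          by (simp add: \<kappa>_def emeasure_ball content_ball)
        then have "\<kappa> \<le> measure moment_measure (ball x \<delta>)"
          using fm \<kappa> by (simp add: emeasure_eq_measure2 ennreal_le_iff)
        moreover have "f (\<delta> - d / 2) \<le> measure moment_measure (outer_parallel \<delta> A)"
          using A(3) d(1) by (simp add: f_def moment_dominates_def)
        moreover have "measure moment_measure (ball x \<delta>) + measure moment_measure (outer_parallel \<delta> A)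
            = measure moment_measure (ball x \<delta> \<union> outer_parallel \<delta> A)"
          using measure_Un3[OF fm fmeasurable_moment_measure_compact[OF cA]] disj by simp
        moreover have "\<dots> \<le> f (\<delta> + d / 2)"
          unfolding f_def using borel_compact[OF cA]
          by (intro measure_mono_fmeasurable sub fmeasurable_moment_measure_compact compact_outer_parallel L) auto
        ultimately have "\<kappa> + f (\<delta> - d / 2) \<le> f (\<delta> + d / 2)" by linarith
        moreover have "\<bar>f (\<delta> - d / 2) - f \<delta>\<bar> < \<kappa> / 2" "\<bar>f (\<delta> + d / 2) - f \<delta>\<bar> < \<kappa> / 2"
          using d(1) by (intro d(2); simp)+
        ultimately show False by linarith
      qed
    qed
  qed
qed

section \<open>Sequences of symmetrals\<close>

definition parallel_close :: "real \<Rightarrow> 'a::euclidean_space set \<Rightarrow> 'a set \<Rightarrow> bool" where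
  "parallel_close \<epsilon> A L \<longleftrightarrow> A \<subseteq> outer_parallel \<epsilon> L \<and> L \<subseteq> outer_parallel \<epsilon> A"

lemma parallel_close_mono: "parallel_close \<epsilon> A L \<Longrightarrow> \<epsilon> \<le> \<eta> \<Longrightarrow> parallel_close \<eta> A L"
  unfolding parallel_close_def using outer_parallel_mono[OF order_refl, of \<epsilon> \<eta>] by blast

lemma steiner_symmetral_empty [simp]: "steiner_symmetral u {} = {}"
  by (auto simp: steiner_symmetral_def line_section_def)

lemma steiner_symmetral_nonempty:
  assumes "norm u = 1" "K \<noteq> {}"
  shows "steiner_symmetral u K \<noteq> {}"
proof -
  obtain x where "x \<in> K" using assms by blast
  have uu: "u \<bullet> u = 1" using assms by (simp add: dot_square_norm)
  define y where "y = x - (x \<bullet> u) *\<^sub>R u"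
  have "x \<bullet> u \<in> line_section u K y" using \<open>x \<in> K\<close> by (simp add: line_section_def y_def)
  moreover have "y \<bullet> u = 0" by (simp add: y_def inner_simps uu)
  ultimately have "y \<in> steiner_symmetral u K"
    by (auto simp: steiner_symmetral_iff[OF assms(1)])
  then show ?thesis by blast
qed

lemma
  assumes "norm u = 1" "compact K"
  shows measure_outer_parallel_steiner_symmetral_le:
      "measure moment_measure (outer_parallel \<delta> (steiner_symmetral u K)) \<le>
        measure moment_measure (outer_parallel \<delta> K)"
    and emeasure_outer_parallel_steiner_symmetral_le:
      "emeasure lborel (outer_parallel \<delta> (steiner_symmetral u K)) \<le>
        emeasure lborel (outer_parallel \<delta> K)"
proof -
  have c: "compact (outer_parallel \<delta> K)" "compact (steiner_symmetral u (outer_parallel \<delta> K))"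
    "compact (outer_parallel \<delta> (steiner_symmetral u K))"
    by (intro compact_outer_parallel compact_steiner_symmetral assms)+
  note sub = outer_parallel_steiner_symmetral[OF assms, of \<delta>]
  have "measure moment_measure (outer_parallel \<delta> (steiner_symmetral u K)) \<le>
      measure moment_measure (steiner_symmetral u (outer_parallel \<delta> K))"
    by (rule measure_moment_measure_mono[OF c(3,2) sub])
  also have "\<dots> \<le> measure moment_measure (outer_parallel \<delta> K)"
    using emeasure_moment_measure_steiner_symmetral_le[OF assms(1) c(1)]
      fmeasurable_moment_measure_compact[OF c(1)] fmeasurable_moment_measure_compact[OF c(2)]
    by (simp add: emeasure_eq_measure2)
  finally show "measure moment_measure (outer_parallel \<delta> (steiner_symmetral u K)) \<le>
        measure moment_measure (outer_parallel \<delta> K)" .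
  show "emeasure lborel (outer_parallel \<delta> (steiner_symmetral u K)) \<le>
        emeasure lborel (outer_parallel \<delta> K)"
    using emeasure_mono[OF sub, of lborel] borel_compact[OF c(2)]
      emeasure_steiner_symmetral[OF assms(1) c(1)] by simp
qed

lemma steiner_symmetral_subset_outer_parallel:
  assumes "norm v = 1" "compact A" "compact L" "0 < \<epsilon>" "parallel_invariant v L"
    and "A \<subseteq> outer_parallel \<epsilon> L"
  shows "steiner_symmetral v A \<subseteq> outer_parallel \<epsilon> L"
  using steiner_symmetral_mono[OF assms(1,2) compact_outer_parallel[OF assms(3)] assms(6)] assms(4,5)
  by (auto simp: parallel_invariant_def)

text \<open>If every \<open>w\<close> failed at some positive \<open>e w\<close>, the least of these
  finitely many values would have no witness at all.\<close>

lemma finite_uniform_witness: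
  fixes Q :: "real \<Rightarrow> 'b \<Rightarrow> bool"
  assumes "finite B" "\<And>\<epsilon>. 0 < \<epsilon> \<Longrightarrow> \<exists>w\<in>B. Q \<epsilon> w"
    and mono: "\<And>\<epsilon> \<eta> w. Q \<epsilon> w \<Longrightarrow> \<epsilon> \<le> \<eta> \<Longrightarrow> Q \<eta> w"
  shows "\<exists>w\<in>B. \<forall>\<epsilon>>0. Q \<epsilon> w"
proof (rule ccontr)
  assume "\<not> ?thesis"
  then obtain e where e: "\<And>w. w \<in> B \<Longrightarrow> 0 < e w \<and> \<not> Q (e w) w" by metis
  have "B \<noteq> {}" using assms(2)[of 1] by auto
  then have "0 < Min (e ` B)" using e assms(1) by simp
  then obtain w where "w \<in> B" "Q (Min (e ` B)) w" using assms(2) by blast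
  moreover have "Min (e ` B) \<le> e w" using \<open>w \<in> B\<close> assms(1) by simp
  ultimately show False using mono[of _ w "e w"] e by blast
qed

section \<open>The sequence generated by a finite set of directions\<close>

locale symmetral_sequence =
  fixes F :: "'a::euclidean_space set" and u :: "nat \<Rightarrow> 'a" and K :: "'a set"
  assumes finite_F: "finite F" and F_sphere: "F \<subseteq> sphere 0 1"
    and u_in_F: "\<And>m. m \<ge> 1 \<Longrightarrow> u m \<in> F"
    and K: "compact K"
begin

abbreviation "Km \<equiv> iterated_symmetral u K"

definition recurrent :: "'a set" where
  "recurrent = {v \<in> F. infinite {m. m \<ge> 1 \<and> u m = v}}"

lemma norm_F: "v \<in> F \<Longrightarrow> norm v = 1"
  using F_sphere by auto

lemma norm_u: "norm (u (Suc m)) = 1"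
  using norm_F u_in_F by simp

lemma compact_Km: "compact (Km m)"
  by (induction m) (auto intro: K compact_steiner_symmetral norm_u)

lemma emeasure_Km: "emeasure lborel (Km m) = emeasure lborel K"
  by (induction m) (auto simp: emeasure_steiner_symmetral[OF norm_u compact_Km])

lemma eventually_recurrent: "\<exists>N. \<forall>m\<ge>N. u (Suc m) \<in> recurrent"
proof -
  have "finite (\<Union>v\<in>F - recurrent. {m. m \<ge> 1 \<and> u m = v})"
    using finite_F by (auto simp: recurrent_def)
  then obtain N where N: "\<And>m. m \<in> (\<Union>v\<in>F - recurrent. {m. m \<ge> 1 \<and> u m = v}) \<Longrightarrow> m \<le> N"
    by (meson finite_nat_set_iff_bounded_le)
  have "u (Suc m) \<in> recurrent" if "m \<ge> N" for m
  proof (rule ccontr)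
    assume "u (Suc m) \<notin> recurrent"
    then have "Suc m \<le> N" using u_in_F[of "Suc m"] by (intro N) auto
    then show False using that by simp
  qed
  then show ?thesis by blast
qed

text \<open>A cluster point of the sequence in the Hausdorff metric, phrased without a subsequence
  so that arbitrarily late close members are directly available.\<close>

definition cluster_set :: "'a set \<Rightarrow> bool" where
  "cluster_set L \<longleftrightarrow> compact L \<and> (\<forall>\<epsilon>>0. \<forall>N. \<exists>m\<ge>N. parallel_close \<epsilon> (Km m) L)"

lemma ex_cluster_set:
  assumes "K \<noteq> {}"
  shows "\<exists>L. cluster_set L"
proof -
  have ne: "Km m \<noteq> {}" for m
    by (induction m) (auto simp: assms steiner_symmetral_nonempty[OF norm_u])
  obtain R where R: "K \<subseteq> cball 0 R"
    using compact_imp_bounded[OF K] by (auto simp: bounded_iff subset_iff)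
  have bd: "Km m \<subseteq> cball 0 R" for m
    by (induction m) (simp_all add: R steiner_symmetral_subset_cball[OF norm_u])
  obtain L r where L: "compact L" "strict_mono (r :: nat \<Rightarrow> nat)"
    "\<And>\<epsilon>. 0 < \<epsilon> \<Longrightarrow> \<forall>\<^sub>F j in sequentially.
       Km (r j) \<subseteq> outer_parallel \<epsilon> L \<and> L \<subseteq> outer_parallel \<epsilon> (Km (r j))"
    by (rule Blaschke_selection[of Km R, OF compact_Km ne bd]) blast
  have "\<exists>m\<ge>N. parallel_close \<epsilon> (Km m) L" if pos: "0 < \<epsilon>" for \<epsilon> N
  proof -
    obtain j where "j \<ge> N" "parallel_close \<epsilon> (Km (r j)) L"
      using L(3)[OF pos] unfolding eventually_sequentially parallel_close_def[symmetric]
      by (meson max.cobounded1 max.cobounded2)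
    moreover have "j \<le> r j" by (rule seq_suble[OF L(2)])
    ultimately show ?thesis by (intro exI[of _ "r j"]) auto
  qed
  then show ?thesis using L(1) by (auto simp: cluster_set_def)
qed

lemma antimono_measure_outer_parallel:
  assumes "m \<le> n"
  shows "measure moment_measure (outer_parallel \<delta> (Km n)) \<le> measure moment_measure (outer_parallel \<delta> (Km m))"
    and "emeasure lborel (outer_parallel \<delta> (Km n)) \<le> emeasure lborel (outer_parallel \<delta> (Km m))"
proof -
  have "antimono (\<lambda>i. measure moment_measure (outer_parallel \<delta> (Km i)))"
    "antimono (\<lambda>i. emeasure lborel (outer_parallel \<delta> (Km i)))"
    by (simp_all add: decseq_Suc_iff measure_outer_parallel_steiner_symmetral_le[OF norm_u compact_Km]
      emeasure_outer_parallel_steiner_symmetral_le[OF norm_u compact_Km])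
  then show "measure moment_measure (outer_parallel \<delta> (Km n)) \<le> measure moment_measure (outer_parallel \<delta> (Km m))"
    and "emeasure lborel (outer_parallel \<delta> (Km n)) \<le> emeasure lborel (outer_parallel \<delta> (Km m))"
    using assms by (auto dest: antimonoD)
qed

text \<open>Some later member is so close to \<open>L\<close> that its parallel sets cover slightly
  thinner ones of \<open>L\<close>, and moments of parallel sets only decrease up to that
  member.\<close>

lemma moment_dominates_cluster_set:
  assumes "cluster_set L"
  shows "moment_dominates (Km m) L"
  unfolding moment_dominates_def
proof (intro allI impI)
  fix \<delta>' \<delta> :: real assume "\<delta>' < \<delta>"
  then have "0 < \<delta> - \<delta>'" by simp
  then obtain n where n: "n \<ge> m" "parallel_close (\<delta> - \<delta>') (Km n) L"
    using assms unfolding cluster_set_def by blast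
  have "outer_parallel \<delta>' L \<subseteq> outer_parallel \<delta> (Km n)"
    using outer_parallel_subset_add[of L "\<delta> - \<delta>'" "Km n" \<delta>'] n(2) by (simp add: parallel_close_def)
  then have "measure moment_measure (outer_parallel \<delta>' L) \<le> measure moment_measure (outer_parallel \<delta> (Km n))"
    using assms by (intro measure_moment_measure_mono compact_outer_parallel compact_Km)
      (auto simp: cluster_set_def)
  also have "\<dots> \<le> measure moment_measure (outer_parallel \<delta> (Km m))"
    by (rule antimono_measure_outer_parallel(1)[OF n(1)])
  finally show "measure moment_measure (outer_parallel \<delta>' L) \<le> measure moment_measure (outer_parallel \<delta> (Km m))" .
qed

text \<open>Invariance preserves the inclusion of the members in a parallel set of \<open>L\<close>.
  The opposite inclusion is not propagated but recovered at index \<open>n\<close> from domination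
  of moments, which holds at every index.\<close>

lemma parallel_close_persists:
  assumes "cluster_set L" "0 < \<eta>"
  obtains \<epsilon> where "0 < \<epsilon>"
    "\<And>m n. m \<le> n \<Longrightarrow> parallel_close \<epsilon> (Km m) L \<Longrightarrow>
      (\<And>i. m \<le> i \<Longrightarrow> i < n \<Longrightarrow> parallel_invariant (u (Suc i)) L) \<Longrightarrow> parallel_close \<eta> (Km n) L"
proof -
  have L: "compact L" using assms(1) by (simp add: cluster_set_def)
  obtain e where e: "0 < e"
    "\<And>A. compact A \<Longrightarrow> A \<subseteq> outer_parallel e L \<Longrightarrow> moment_dominates A L \<Longrightarrow> L \<subseteq> outer_parallel \<eta> A"
    using subset_outer_parallel_if_moment_dominates[OF L assms(2)] by blast
  define \<epsilon> where "\<epsilon> = min e \<eta>"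
  have \<epsilon>: "0 < \<epsilon>" "\<epsilon> \<le> e" "\<epsilon> \<le> \<eta>" using e(1) assms(2) by (auto simp: \<epsilon>_def)
  have "parallel_close \<eta> (Km n) L"
    if "m \<le> n" "parallel_close \<epsilon> (Km m) L"
      "\<And>i. m \<le> i \<Longrightarrow> i < n \<Longrightarrow> parallel_invariant (u (Suc i)) L" for m n
  proof -
    have "Km n \<subseteq> outer_parallel \<epsilon> L"
      using that
    proof (induction n rule: dec_induct)
      case base
      then show ?case by (simp add: parallel_close_def)
    next
      case (step i)
      have "Km i \<subseteq> outer_parallel \<epsilon> L" by (rule step.IH) (use step.prems in auto)
      then have "steiner_symmetral (u (Suc i)) (Km i) \<subseteq> outer_parallel \<epsilon> L"
        using step by (intro steiner_symmetral_subset_outer_parallel[OF norm_u compact_Km L \<epsilon>(1)]) auto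
      then show ?case by simp
    qed
    then show ?thesis
      using e(2)[OF compact_Km _ moment_dominates_cluster_set[OF assms(1)], of n]
        outer_parallel_mono[OF order_refl \<epsilon>(2), of L] outer_parallel_mono[OF order_refl \<epsilon>(3), of L]
      unfolding parallel_close_def by blast
  qed
  with \<epsilon>(1) show ?thesis by (rule that)
qed

text \<open>A limit set is invariant under every recurrent direction: stopping just before the first use of a
  direction under which \<open>L\<close> is not yet known to be invariant keeps the sequence close to \<open>L\<close>,
  so some such direction \<open>w\<close> is applied to sets arbitrarily close to \<open>L\<close>, which makes
  \<open>L\<close> invariant under \<open>w\<close>.\<close>

lemma cluster_set_invariant:
  assumes "cluster_set L" "v \<in> recurrent"
  shows "parallel_invariant v L"
proof (rule ccontr)
  assume nv: "\<not> parallel_invariant v L"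
  define B where "B = {w \<in> recurrent. \<not> parallel_invariant w L}"
  have L: "compact L" using assms(1) by (simp add: cluster_set_def)
  obtain N where N: "\<And>m. m \<ge> N \<Longrightarrow> u (Suc m) \<in> recurrent" using eventually_recurrent by blast
  have "\<exists>w\<in>B. \<exists>n. parallel_close \<eta> (Km n) L \<and> u (Suc n) = w" if \<eta>: "0 < \<eta>" for \<eta>
  proof -
    obtain \<epsilon> where \<epsilon>: "0 < \<epsilon>"
      "\<And>m n. m \<le> n \<Longrightarrow> parallel_close \<epsilon> (Km m) L \<Longrightarrow>
        (\<And>i. m \<le> i \<Longrightarrow> i < n \<Longrightarrow> parallel_invariant (u (Suc i)) L) \<Longrightarrow> parallel_close \<eta> (Km n) L"
      using parallel_close_persists[OF assms(1) \<eta>] by blast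
    obtain m where m: "m \<ge> N" "parallel_close \<epsilon> (Km m) L"
      using assms(1) \<epsilon>(1) by (auto simp: cluster_set_def)
    define P where "P = (\<lambda>n. m \<le> n \<and> \<not> parallel_invariant (u (Suc n)) L)"
    have "infinite {m. m \<ge> 1 \<and> u m = v}" using assms(2) by (simp add: recurrent_def)
    then obtain k where "k > m" "u k = v" by (auto simp: infinite_nat_iff_unbounded)
    \<comment> \<open>The step with direction \<open>u k\<close> is applied to
      \<open>Km (k - 1)\<close>; recurrence of \<open>v\<close> thus ensures that a first bad step
      exists.\<close>
    then have "P (k - 1)" using nv by (auto simp: P_def)
    define n where "n = (LEAST n. P n)"
    have "P n" unfolding n_def by (rule LeastI[of P, OF \<open>P (k - 1)\<close>])
    moreover have "\<not> P i" if "i < n" for i using that unfolding n_def by (rule not_less_Least)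
    ultimately have "m \<le> n" "u (Suc n) \<in> B" "\<And>i. m \<le> i \<Longrightarrow> i < n \<Longrightarrow> parallel_invariant (u (Suc i)) L"
      using m(1) N by (auto simp: P_def B_def)
    then show ?thesis using \<epsilon>(2)[of m n] m(2) by blast
  qed
  moreover have "finite B" using finite_F by (simp add: B_def recurrent_def)
  \<comment> \<open>Finiteness of \<open>B\<close> lets one direction \<open>w\<close> serve for all
    \<open>\<eta>\<close>.\<close>
  ultimately obtain w where w: "w \<in> B" "\<forall>\<eta>>0. \<exists>n. parallel_close \<eta> (Km n) L \<and> u (Suc n) = w"
    using finite_uniform_witness[of B "\<lambda>\<eta> w. \<exists>n. parallel_close \<eta> (Km n) L \<and> u (Suc n) = w"]
      parallel_close_mono by blast
  have "parallel_invariant w L"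
  proof (rule parallel_invariantI[OF _ L])
    show "norm w = 1" using w(1) by (simp add: B_def recurrent_def norm_F)
    fix \<epsilon> :: real assume "0 < \<epsilon>"
    then obtain n where n: "parallel_close \<epsilon> (Km n) L" "u (Suc n) = w" using w(2) by blast
    \<comment> \<open>With \<open>A = Km n\<close>, the symmetral in direction \<open>w\<close> is
      the next member \<open>Km (Suc n)\<close>, which dominates \<open>L\<close>.\<close>
    then show "\<exists>A. compact A \<and> A \<subseteq> outer_parallel \<epsilon> L \<and> moment_dominates (steiner_symmetral w A) L"
      using moment_dominates_cluster_set[OF assms(1), of "Suc n"] compact_Km[of n]
      by (intro exI[of _ "Km n"]) (auto simp: parallel_close_def)
  qed
  then show False using w(1) by (simp add: B_def)
qed

text \<open>Eventually only recurrent directions are used, and all of them leave \<open>L\<close>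
  invariant, so one late member close to \<open>L\<close> keeps all later ones close.\<close>

lemma eventually_parallel_close:
  assumes "cluster_set L" "0 < \<eta>"
  shows "\<forall>\<^sub>F n in sequentially. parallel_close \<eta> (Km n) L"
proof -
  obtain N where N: "\<And>m. m \<ge> N \<Longrightarrow> u (Suc m) \<in> recurrent" using eventually_recurrent by blast
  obtain \<epsilon> where \<epsilon>: "0 < \<epsilon>"
    "\<And>m n. m \<le> n \<Longrightarrow> parallel_close \<epsilon> (Km m) L \<Longrightarrow>
      (\<And>i. m \<le> i \<Longrightarrow> i < n \<Longrightarrow> parallel_invariant (u (Suc i)) L) \<Longrightarrow> parallel_close \<eta> (Km n) L"
    using parallel_close_persists[OF assms] by blast
  obtain m where m: "m \<ge> N" "parallel_close \<epsilon> (Km m) L"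
    using assms(1) \<epsilon>(1) by (auto simp: cluster_set_def)
  have "parallel_close \<eta> (Km n) L" if "n \<ge> m" for n
    using cluster_set_invariant[OF assms(1)] N m that by (intro \<epsilon>(2)[of m n]) auto
  then show ?thesis unfolding eventually_sequentially by blast
qed

end

section \<open>Convergence of volumes and of symmetric differences\<close>

lemma emeasure_outer_parallel_tendsto:
  fixes L :: "'a::euclidean_space set"
  assumes "compact L"
  shows "(\<lambda>n. emeasure lborel (outer_parallel (1 / real (Suc n)) L)) \<longlonglongrightarrow> emeasure lborel L"
proof -
  have "(\<lambda>n. emeasure lborel (outer_parallel (1 / real (Suc n)) L))
      \<longlonglongrightarrow> emeasure lborel (\<Inter>n. outer_parallel (1 / real (Suc n)) L)"
  proof (rule Lim_emeasure_decseq)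
    show "range (\<lambda>n. outer_parallel (1 / real (Suc n)) L) \<subseteq> sets lborel"
      using borel_compact[OF compact_outer_parallel[OF assms]] by auto
    show "decseq (\<lambda>n. outer_parallel (1 / real (Suc n)) L)"
      by (intro decseq_SucI outer_parallel_mono) (auto simp: field_simps)
    show "emeasure lborel (outer_parallel (1 / real (Suc n)) L) \<noteq> \<infinity>" for n
      using emeasure_compact_finite[OF compact_outer_parallel[OF assms]] by (simp add: less_top)
  qed
  then show ?thesis by (simp only: INT_outer_parallel[OF compact_imp_closed[OF assms]])
qed

context symmetral_sequence
begin

text \<open>Hausdorff convergence alone allows the limit to have larger volume. Here
  \<open>L\<close> lies in thin parallel sets of members, whose volume is at most that of the
  parallel sets of \<open>K\<close>.\<close>

lemma emeasure_cluster_set_le: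
  assumes "cluster_set L"
  shows "emeasure lborel L \<le> emeasure lborel K"
proof (rule tendsto_lowerbound[OF emeasure_outer_parallel_tendsto[OF K]])
  have "emeasure lborel L \<le> emeasure lborel (outer_parallel (1 / real (Suc n)) K)" for n
  proof -
    obtain m where m: "parallel_close (1 / real (Suc n)) (Km m) L"
      using assms unfolding cluster_set_def by (meson of_nat_0_less_iff zero_less_Suc zero_less_divide_1_iff)
    then have "emeasure lborel L \<le> emeasure lborel (outer_parallel (1 / real (Suc n)) (Km m))"
      using borel_compact[OF compact_outer_parallel[OF compact_Km]]
      by (intro emeasure_mono) (auto simp: parallel_close_def)
    also have "\<dots> \<le> emeasure lborel (outer_parallel (1 / real (Suc n)) K)"
      using antimono_measure_outer_parallel(2)[of 0 m] by simp
    finally show ?thesis .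
  qed
  then show "\<forall>\<^sub>F n in sequentially. emeasure lborel L \<le> emeasure lborel (outer_parallel (1 / real (Suc n)) K)"
    by simp
qed simp

lemma hausdorff_distance_tendsto:
  assumes "cluster_set L"
  shows "(\<lambda>m. hausdorff_distance (Km m) L) \<longlonglongrightarrow> 0"
proof (rule order_tendstoI)
  fix a :: ereal assume "a < 0"
  moreover have "0 \<le> hausdorff_distance (Km m) L" for m
    unfolding hausdorff_distance_def by (intro Inf_greatest) auto
  ultimately show "\<forall>\<^sub>F m in sequentially. a < hausdorff_distance (Km m) L"
    by (intro always_eventually allI) (rule less_le_trans)
next
  fix a :: ereal assume "0 < a"
  then obtain e where e: "0 < ereal e" "ereal e < a" using ereal_dense2 by blast
  then have "0 < e" by simp
  from eventually_parallel_close[OF assms this]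
  show "\<forall>\<^sub>F m in sequentially. hausdorff_distance (Km m) L < a"
  proof eventually_elim
    case (elim m)
    then have "hausdorff_distance (Km m) L \<le> ereal e"
      using \<open>0 < e\<close> unfolding hausdorff_distance_def parallel_close_def by (intro Inf_lower) auto
    then show ?case using e(2) by (rule le_less_trans)
  qed
qed

text \<open>Eventually \<open>Km m - L\<close> lies in a thin shell around \<open>L\<close>. Since
  \<open>Km m\<close> has at least the volume of \<open>L\<close>, the other part
  \<open>L - Km m\<close> is no larger than \<open>Km m - L\<close>.\<close>

lemma emeasure_sym_diff_tendsto:
  assumes "cluster_set L"
  shows "(\<lambda>m. emeasure lebesgue (sym_diff (Km m) L)) \<longlonglongrightarrow> 0"
proof (rule order_tendstoI)
  fix a :: ennreal assume "0 < a"
  have L: "compact L" using assms by (simp add: cluster_set_def)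
  define P where "P = (\<lambda>n. outer_parallel (1 / real (Suc n)) L)"
  have P: "compact (P n)" for n unfolding P_def by (rule compact_outer_parallel[OF L])
  have finite: "emeasure lborel C \<noteq> \<infinity>" if "compact C" for C :: "'a set"
    using emeasure_compact_finite[OF that] by (simp add: less_top)
  have fL: "emeasure lborel L \<noteq> top" using finite[OF L] by simp
  have "(\<lambda>n. emeasure lborel (P n) - emeasure lborel L) \<longlonglongrightarrow> emeasure lborel L - emeasure lborel L"
    unfolding P_def
    by (rule tendsto_diff_ennreal[OF emeasure_outer_parallel_tendsto[OF L] tendsto_const fL fL])
  then have "(\<lambda>n. 2 * (emeasure lborel (P n) - emeasure lborel L)) \<longlonglongrightarrow> 2 * (emeasure lborel L - emeasure lborel L)"
    by (rule ennreal_tendsto_cmult[rotated]) (simp add: less_top)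
  then have lim: "(\<lambda>n. 2 * (emeasure lborel (P n) - emeasure lborel L)) \<longlonglongrightarrow> 0"
    unfolding ennreal_diff_self[OF fL] mult_zero_right .
  obtain n where n: "2 * (emeasure lborel (P n) - emeasure lborel L) < a"
    using eventually_happens'[OF sequentially_bot order_tendstoD(2)[OF lim \<open>0 < a\<close>]] ..
  have "\<forall>\<^sub>F m in sequentially. parallel_close (1 / real (Suc n)) (Km m) L"
    by (rule eventually_parallel_close[OF assms]) simp
  then show "\<forall>\<^sub>F m in sequentially. emeasure lebesgue (sym_diff (Km m) L) < a"
  proof eventually_elim
    case (elim m)
    have [measurable]: "L \<in> sets borel" "Km m \<in> sets borel" "P n \<in> sets borel"
      using L P compact_Km by (auto intro: borel_compact)
    have "L \<subseteq> P n" unfolding P_def by (rule subset_outer_parallel) simp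
    have "emeasure lborel (Km m - L) \<le> emeasure lborel (P n - L)"
    proof (rule emeasure_mono)
      show "Km m - L \<subseteq> P n - L" using elim unfolding parallel_close_def P_def by blast
    qed measurable
    also have "\<dots> = emeasure lborel (P n) - emeasure lborel L"
      using finite[OF L] \<open>L \<subseteq> P n\<close> by (intro emeasure_Diff) auto
    finally have 1: "emeasure lborel (Km m - L) \<le> emeasure lborel (P n) - emeasure lborel L" .
    have "emeasure lborel (L \<inter> Km m) + emeasure lborel (L - Km m) = emeasure lborel L"
      by (subst plus_emeasure) (auto intro!: arg_cong[where f="emeasure lborel"])
    also have "\<dots> \<le> emeasure lborel (Km m)"
      using emeasure_cluster_set_le[OF assms] by (simp add: emeasure_Km)
    also have "\<dots> = emeasure lborel (L \<inter> Km m) + emeasure lborel (Km m - L)"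
      by (subst plus_emeasure) (auto intro!: arg_cong[where f="emeasure lborel"])
    finally have 2: "emeasure lborel (L - Km m) \<le> emeasure lborel (Km m - L)"
      using finite[OF compact_Int[OF L compact_Km[of m]]]
      by (simp add: ennreal_add_left_cancel_le)
    have "emeasure lebesgue (sym_diff (Km m) L) = emeasure lborel (sym_diff (Km m) L)"
      by simp
    also have "\<dots> \<le> emeasure lborel (Km m - L) + emeasure lborel (L - Km m)"
      by (rule emeasure_subadditive) auto
    also have "\<dots> \<le> 2 * (emeasure lborel (P n) - emeasure lborel L)"
      unfolding mult_2 by (rule add_mono[OF 1 order_trans[OF 2 1]])
    finally show ?case using n by (rule le_less_trans)
  qed
qed simp

end

theorem theorem6p1:
  fixes F :: "(real ^ 'n) set" and u :: "nat \<Rightarrow> real ^ 'n" and K :: "(real ^ 'n) set"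
  assumes "finite F" and "F \<subseteq> sphere 0 1"
    and "\<And>m. m \<ge> 1 \<Longrightarrow> u m \<in> F"
    and "compact K"
  shows "\<exists>L. compact L \<and>
      (\<lambda>m. hausdorff_distance (iterated_symmetral u K m) L) \<longlonglongrightarrow> 0 \<and>
      (\<lambda>m. emeasure lebesgue (sym_diff (iterated_symmetral u K m) L)) \<longlonglongrightarrow> 0 \<and>
      (\<forall>v\<in>F. infinite {m. m \<ge> 1 \<and> u m = v} \<longrightarrow> hyperplane_reflection v ` L = L)"
proof -
  interpret symmetral_sequence F u K by unfold_locales (use assms in auto)
  have "\<exists>L. cluster_set L"
  proof (cases "K = {}")
    case True
    \<comment> \<open>The selection theorem needs nonempty sets; for empty \<open>K\<close> the
      empty set is itself the limit.\<close>
    have "Km m = {}" for m by (induction m) (auto simp: True)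
    then have "cluster_set {}" by (auto simp: cluster_set_def parallel_close_def)
    then show ?thesis ..
  qed (rule ex_cluster_set)
  then obtain L where L: "cluster_set L" ..
  have "hyperplane_reflection v ` L = L" if "v \<in> F" "infinite {m. m \<ge> 1 \<and> u m = v}" for v
    using cluster_set_invariant[OF L, of v] that by (simp add: recurrent_def parallel_invariant_def)
  then show ?thesis
    using L hausdorff_distance_tendsto[OF L] emeasure_sym_diff_tendsto[OF L]
    by (auto simp: cluster_set_def)
qed

end
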